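(* Let $X$ be a Polish space and let $I$ be an actionable $\sigma$-ideal on $X$. Then the poset $P_I$ of Borel $I$-positive subsets of $X$, ordered by inclusion, is proper.
   Context: For a Polish space $X$, $X^{\leq\omega}$ denotes the space of all finite sequences and all $\omega$-sequences of elements of $X$. A hypergraph on $X$ is a set $G\subset X^{\leq\omega}$; its elements are called edges, and the vertices of an edge $e$ are the elements of $\mathrm{rng}(e)$. $G$ is analytic if it is an analytic subset of $X^{\leq\omega}$. A $G$-anticlique is a set $B\subset X$ with $B^{\leq\omega}\cap G=\emptyset$. A countable set $\mathcal{G}$ of analytic hypergraphs on $X$ is actionable if there are a countable group $\Gamma$ and a Borel action of $\Gamma$ on $X$ such that (1) the range of every edge of every hypergraph in $\mathcal{G}$ is a subset of a single $\Gamma$-orbit, and (2) for every $G\in\mathcal{G}$ and $\gamma\in\Gamma$, $\gamma\cdot G\in\mathcal{G}$, where $\gamma\cdot G$ is obtained by applying $\gamma$ to all vertices of all edges of $G$. A $\sigma$-ideal $I$ on $X$ is actionable if there is an actionable collection $\mathcal{G}$ of hypergraphs on $X$ such that $I$ is $\sigma$-generated by the Borel sets which are anticliques in at least one of the hypergraphs in $\mathcal{G}$ (that is, a set is in $I$ iff it is covered by countably many such Borel sets). A set is $I$-positive if it does not belong to $I$. *)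

theory Defs
  imports "HOL-Analysis.Analysis" "HOL-Algebra.Group_Action"
begin

unbundle cardinal_syntax

section \<open>Hypergraphs and actionable ideals\<close>

text \<open>The space of sequences of length at most omega is the disjoint sum, over \<open>n \<le> \<infinity>\<close>, of the
  powers of the space. An element is a pair \<open>(n, s)\<close> where \<open>s\<close> is extensional (equal to
  \<open>undefined\<close>) outside its index set \<open>{i. enat i < n}\<close>; \<open>n = \<infinity>\<close> gives the omega-sequences.\<close>

type_synonym 'a edge = "enat \<times> (nat \<Rightarrow> 'a)"

definition seq_space :: "'a::topological_space edge topology" where
  "seq_space = sum_topology (\<lambda>n. product_topology (\<lambda>_. euclidean) {i. enat i < n}) UNIV"

definition seqs :: "'a set \<Rightarrow> 'a edge set" where
  "seqs B = (SIGMA n:UNIV. {i. enat i < n} \<rightarrow>\<^sub>E B)"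

lemma topspace_seq_space: "topspace seq_space = seqs UNIV"
  by (auto simp: seq_space_def seqs_def)

definition rng :: "'a edge \<Rightarrow> 'a set" where
  "rng e = snd e ` {i. enat i < fst e}"

lemma seqs_iff_rng: "e \<in> seqs B \<longleftrightarrow> e \<in> seqs UNIV \<and> rng e \<subseteq> B"
  by (auto simp: seqs_def rng_def PiE_iff split: prod.splits)

definition map_edge :: "('a \<Rightarrow> 'b) \<Rightarrow> 'a edge \<Rightarrow> 'b edge" where
  "map_edge h e = (fst e, \<lambda>i\<in>{i. enat i < fst e}. h (snd e i))"

text \<open>Analytic subsets of a Polish space: the empty set and the continuous images of the Baire
  space \<open>nat \<Rightarrow> nat\<close>.\<close>

definition analytic_in :: "'b topology \<Rightarrow> 'b set \<Rightarrow> bool" where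
  "analytic_in T A \<longleftrightarrow>
     A = {} \<or> (\<exists>f::(nat \<Rightarrow> nat) \<Rightarrow> 'b. continuous_map euclidean T f \<and> A = range f)"

definition anticlique :: "'a edge set \<Rightarrow> 'a set \<Rightarrow> bool" where
  "anticlique G B \<longleftrightarrow> seqs B \<inter> G = {}"

definition borel_action :: "('g, 'm) monoid_scheme \<Rightarrow> ('g \<Rightarrow> 'a::topological_space \<Rightarrow> 'a) \<Rightarrow> bool" where
  "borel_action \<Gamma> \<phi> \<longleftrightarrow>
     group_action \<Gamma> UNIV \<phi> \<and> (\<forall>g\<in>carrier \<Gamma>. \<phi> g \<in> borel \<rightarrow>\<^sub>M borel)"

text \<open>Every countable group is isomorphic to one whose elements are natural numbers, so the
  quantification over all countable groups is over \<open>nat monoid\<close>.\<close>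

definition actionable_hypergraphs :: "'a::polish_space edge set set \<Rightarrow> bool" where
  "actionable_hypergraphs \<G> \<longleftrightarrow>
     countable \<G> \<and> (\<forall>G\<in>\<G>. analytic_in seq_space G) \<and>
     (\<exists>(\<Gamma>::nat monoid) \<phi>. borel_action \<Gamma> \<phi> \<and>
        (\<forall>G\<in>\<G>. \<forall>e\<in>G. \<exists>Q\<in>orbits \<Gamma> UNIV \<phi>. rng e \<subseteq> Q) \<and>
        (\<forall>G\<in>\<G>. \<forall>g\<in>carrier \<Gamma>. map_edge (\<phi> g) ` G \<in> \<G>))"

definition sigma_ideal :: "'a set set \<Rightarrow> bool" where
  "sigma_ideal I \<longleftrightarrow>
     {} \<in> I \<and> (\<forall>A\<in>I. \<forall>B\<subseteq>A. B \<in> I) \<and> (\<forall>\<C>\<subseteq>I. countable \<C> \<longrightarrow> \<Union>\<C> \<in> I)"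

definition actionable_sigma_ideal :: "'a::polish_space set set \<Rightarrow> bool" where
  "actionable_sigma_ideal I \<longleftrightarrow>
     sigma_ideal I \<and>
     (\<exists>\<G>. actionable_hypergraphs \<G> \<and>
        (\<forall>A. A \<in> I \<longleftrightarrow>
           (\<exists>\<C>. countable \<C> \<and> \<C> \<subseteq> {B \<in> sets borel. \<exists>G\<in>\<G>. anticlique G B} \<and> A \<subseteq> \<Union>\<C>)))"

definition positive_borel :: "'a::topological_space set set \<Rightarrow> 'a set set" where
  "positive_borel I = sets borel - I"


section \<open>Elementary submodels\<close>

text \<open>First-order formulas in the language of set theory, with variables named by natural
  numbers; \<open>E\<close> relates elements to the sets containing them.\<close>

datatype fm = Mem nat nat | Eql nat nat | Neg fm | Conj fm fm | Exi nat fm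

primrec sat :: "'u set \<Rightarrow> 'u rel \<Rightarrow> fm \<Rightarrow> (nat \<Rightarrow> 'u) \<Rightarrow> bool" where
  "sat U E (Mem i j) v \<longleftrightarrow> (v i, v j) \<in> E"
| "sat U E (Eql i j) v \<longleftrightarrow> v i = v j"
| "sat U E (Neg \<alpha>) v \<longleftrightarrow> \<not> sat U E \<alpha> v"
| "sat U E (Conj \<alpha> \<beta>) v \<longleftrightarrow> sat U E \<alpha> v \<and> sat U E \<beta> v"
| "sat U E (Exi i \<alpha>) v \<longleftrightarrow> (\<exists>a\<in>U. sat U E \<alpha> (v(i := a)))"

definition elementary_submodel :: "'u set \<Rightarrow> 'u set \<Rightarrow> 'u rel \<Rightarrow> bool" where
  "elementary_submodel M U E \<longleftrightarrow>
     M \<subseteq> U \<and> (\<forall>\<alpha> v. range v \<subseteq> M \<longrightarrow> (sat M E \<alpha> v \<longleftrightarrow> sat U E \<alpha> v))"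


section \<open>Proper posets\<close>

definition ext :: "'u rel \<Rightarrow> 'u \<Rightarrow> 'u set" where
  "ext E a = {x. (x, a) \<in> E}"

text \<open>For a regular uncountable cardinal \<open>\<theta>\<close>, the structure \<open>H(\<theta>)\<close> of sets of hereditary
  cardinality less than \<open>\<theta>\<close>, with membership, is up to a unique isomorphism the only well-founded
  extensional structure in which the extensions of the elements are exactly the subsets of the
  structure of cardinality less than \<open>\<theta>\<close> (collapse it transitively).\<close>

definition is_H :: "'u rel \<Rightarrow> 'u set \<Rightarrow> 'u rel \<Rightarrow> bool" where
  "is_H \<theta> U E \<longleftrightarrow>
     Card_order \<theta> \<and> natLeq <o \<theta> \<and> regularCard \<theta> \<and>
     E \<subseteq> U \<times> U \<and> wf E \<and> bij_betw (ext E) U {A. A \<subseteq> U \<and> |A| <o \<theta>}"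

text \<open>\<open>z\<close> is the Kuratowski pair of \<open>a\<close> and \<open>b\<close>.\<close>

definition is_pair :: "'u rel \<Rightarrow> 'u \<Rightarrow> 'u \<Rightarrow> 'u \<Rightarrow> bool" where
  "is_pair E z a b \<longleftrightarrow> (\<exists>s t. ext E s = {a} \<and> ext E t = {a, b} \<and> ext E z = {s, t})"

text \<open>Conditions are not themselves elements of \<open>U\<close>; an injection \<open>c\<close> identifies the poset with
  an isomorphic one that is. The elements \<open>P'\<close> and \<open>R'\<close> of \<open>U\<close> are its underlying set and its
  ordering.\<close>

definition poset_in ::
  "'u set \<Rightarrow> 'u rel \<Rightarrow> 'p set \<Rightarrow> ('p \<Rightarrow> 'p \<Rightarrow> bool) \<Rightarrow> ('p \<Rightarrow> 'u) \<Rightarrow> 'u \<Rightarrow> 'u \<Rightarrow> bool" where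
  "poset_in U E P leq c P' R' \<longleftrightarrow>
     inj_on c P \<and> c ` P \<subseteq> U \<and> P' \<in> U \<and> R' \<in> U \<and> ext E P' = c ` P \<and>
     ext E R' = {z. \<exists>p\<in>P. \<exists>q\<in>P. leq p q \<and> is_pair E z (c p) (c q)}"

definition dense_in :: "'p set \<Rightarrow> ('p \<Rightarrow> 'p \<Rightarrow> bool) \<Rightarrow> 'p set \<Rightarrow> bool" where
  "dense_in P leq D \<longleftrightarrow> D \<subseteq> P \<and> (\<forall>p\<in>P. \<exists>d\<in>D. leq d p)"

definition compatible :: "'p set \<Rightarrow> ('p \<Rightarrow> 'p \<Rightarrow> bool) \<Rightarrow> 'p \<Rightarrow> 'p \<Rightarrow> bool" where
  "compatible P leq p q \<longleftrightarrow> (\<exists>r\<in>P. leq r p \<and> leq r q)"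

text \<open>\<open>q\<close> is \<open>(M, P)\<close>-generic: for every dense set \<open>D \<in> M\<close>, the set \<open>D \<inter> M\<close> is predense below \<open>q\<close>.\<close>

definition generic_condition ::
  "'u set \<Rightarrow> 'u rel \<Rightarrow> 'p set \<Rightarrow> ('p \<Rightarrow> 'p \<Rightarrow> bool) \<Rightarrow> ('p \<Rightarrow> 'u) \<Rightarrow> 'p \<Rightarrow> bool" where
  "generic_condition M E P leq c q \<longleftrightarrow>
     q \<in> P \<and>
     (\<forall>D. dense_in P leq D \<and> (\<exists>D'\<in>M. ext E D' = c ` D) \<longrightarrow>
        (\<forall>r\<in>P. leq r q \<longrightarrow> (\<exists>d\<in>D. c d \<in> M \<and> compatible P leq d r)))"

text \<open>Properness: for all large regular \<open>\<theta>\<close> (it suffices that \<open>\<theta>\<close> exceeds the cardinality of the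
  power set of the poset) and every countable elementary submodel \<open>M\<close> of \<open>H(\<theta>)\<close> containing the
  poset, every condition in \<open>M\<close> has an \<open>(M, P)\<close>-generic condition below it.
  A definition cannot quantify over types, so the type \<open>'u\<close> carrying \<open>H(\<theta>)\<close> is a parameter; it is
  to be left as a type variable in theorems, so that all \<open>\<theta>\<close> for which \<open>H(\<theta>)\<close> fits into some type
  are covered. For small \<open>'u\<close> the condition holds vacuously.\<close>

definition proper_poset :: "'u itself \<Rightarrow> 'p set \<Rightarrow> ('p \<Rightarrow> 'p \<Rightarrow> bool) \<Rightarrow> bool" where
  "proper_poset _ P leq \<longleftrightarrow>
     (\<forall>(\<theta>::'u rel) U E c P' R' M.
        is_H \<theta> U E \<and> |Pow P| <o \<theta> \<and> poset_in U E P leq c P' R' \<and>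
        countable M \<and> elementary_submodel M U E \<and> P' \<in> M \<and> R' \<in> M \<longrightarrow>
        (\<forall>p\<in>P. c p \<in> M \<longrightarrow> (\<exists>q\<in>P. leq q p \<and> generic_condition M E P leq c q)))"

end

theory Submission
  imports Defs "HOL-Library.Countable_Set_Type"
begin

text \<open>Let \<open>C\<close> be the set of points of a positive set \<open>p\<close> that lie in some member of each of countably
  many given dense subsets of a sufficiently closed countable family \<open>N\<close> of positive analytic sets.
  If \<open>C\<close> were covered by countably many Borel anticliques, then in the topology generated by \<open>N\<close>
  one of them, say \<open>B\<close> for the hypergraph \<open>G\<close>, would be comeager in some \<open>F \<in> N\<close>. The vertices of the
  \<open>G\<close>-edges inside \<open>F\<close> form a positive analytic set, so some edge inside \<open>F\<close> has a vertex as generic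
  as desired. The group acts on the topology by homeomorphisms and an edge lies within one orbit,
  so all vertices of the edge are that generic and belong to \<open>B\<close>: a contradiction. Hence \<open>C\<close> is positive.

  For a family of analytic sets this, with Lusin separation, yields a Borel positive subset of
  every analytic positive set; therefore countable families of Borel positive sets can be
  sufficiently closed as well, and \<open>C\<close> is then a Borel generic condition. Finally, the club of
  sufficiently closed countable sets is given by parameters in \<open>H(\<theta>)\<close>, which by elementarity may be
  taken in the submodel \<open>M\<close>, so \<open>M\<close> itself belongs to the club.\<close>

section \<open>Analytic sets\<close>

text \<open>Two obstacles shape the proof. The vertices of the edges inside a Borel set form a
  projection, in general only an analytic set; so the closure requirements can at first be met only
  by families of analytic sets, and the category argument has to run once for these before Borel
  families become available. Secondly, \<open>M\<close> is only known to contain a copy of the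
  poset: the space, the ideal, the hypergraphs and the group need not be represented in
  \<open>U\<close>, so \<open>M\<close> cannot be shown directly to be closed under the
  requirements. What is reflected is a statement about the poset alone: for some two parameters,
  every countable closed set containing them has generic conditions. The parameters supplied by
  \<open>M\<close> may differ from those built from the hypergraphs, but they serve equally well.
  Two parameters suffice because a countable set of relations is enumerated by iterating one
  function from a starting point.\<close>

text \<open>Allowing a closed domain, instead of all of the Baire space as in
  \<open>analytic_in\<close>, covers the empty set and keeps the closure proofs simple: a closed
  constraint on codes just cuts the domain down to a smaller closed set.\<close>

definition analytic :: "'b::topological_space set \<Rightarrow> bool" where
  "analytic A \<longleftrightarrow> (\<exists>S (f::(nat \<Rightarrow> nat) \<Rightarrow> 'b). closed S \<and> continuous_on S f \<and> A = f ` S)"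

lemma analyticI:
  fixes f :: "(nat \<Rightarrow> nat) \<Rightarrow> 'b::topological_space"
  shows "closed S \<Longrightarrow> continuous_on S f \<Longrightarrow> A = f ` S \<Longrightarrow> analytic A"
  unfolding analytic_def by blast

lemma analyticE:
  fixes A :: "'b::topological_space set"
  assumes "analytic A"
  obtains S and f :: "(nat \<Rightarrow> nat) \<Rightarrow> 'b" where "closed S" "continuous_on S f" "A = f ` S"
  using assms unfolding analytic_def by blast

text \<open>A point of the Baire space codes the sequence of its slices.\<close>

definition slice :: "nat \<Rightarrow> (nat \<Rightarrow> nat) \<Rightarrow> nat \<Rightarrow> nat" where
  "slice i z = (\<lambda>n. z (prod_encode (i, n)))"

definition merge :: "(nat \<Rightarrow> nat \<Rightarrow> nat) \<Rightarrow> nat \<Rightarrow> nat" where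
  "merge zs = (\<lambda>k. case prod_decode k of (i, n) \<Rightarrow> zs i n)"

lemma slice_merge [simp]: "slice i (merge zs) = zs i"
  by (simp add: slice_def merge_def)

lemma continuous_on_coord: "continuous_on S (\<lambda>z::'i \<Rightarrow> 'b::topological_space. z i)"
  by (rule continuous_on_subset[OF continuous_on_product_coordinates]) simp

lemma continuous_on_slice: "continuous_on S (slice i)"
  unfolding slice_def by (intro continuous_on_coordinatewise_then_product continuous_on_coord)

lemma closed_slice: "closed S \<Longrightarrow> closed {z. slice i z \<in> S}"
  using continuous_closed_preimage[OF continuous_on_slice, of UNIV S i] by (simp add: vimage_def)

lemma open_slice: "open S \<Longrightarrow> open {z. slice i z \<in> S}"
  using continuous_open_preimage[OF continuous_on_slice, of UNIV S i] by (simp add: vimage_def)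

lemma open_coord: "open {z::nat \<Rightarrow> nat. z i \<in> K}"
  using continuous_open_preimage[OF continuous_on_coord, of UNIV K] 
  by (simp add: vimage_def open_discrete)

lemma closed_coord: "closed {z::nat \<Rightarrow> nat. z i \<in> K}"
proof -
  have "- {z::nat \<Rightarrow> nat. z i \<in> K} = {z. z i \<in> - K}" by auto
  then show ?thesis unfolding closed_def using open_coord[of i "- K"] by simp
qed

lemma closed_eq_on:
  fixes f g :: "'c::topological_space \<Rightarrow> 'b::t2_space"
  assumes "closed S" "continuous_on S f" "continuous_on S g"
  shows "closed {x\<in>S. f x = g x}"
proof -
  have "closed (S \<inter> (\<lambda>x. (f x, g x)) -` {y. \<exists>x. y = (x, x)})"
    by (intro continuous_closed_preimage assms continuous_on_Pair closed_diagonal)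
  moreover have "S \<inter> (\<lambda>x. (f x, g x)) -` {y. \<exists>x. y = (x, x)} = {x\<in>S. f x = g x}"
    by auto
  ultimately show ?thesis by simp
qed

lemma continuous_on_comp_slice:
  assumes "continuous_on S f" "\<And>z. z \<in> T \<Longrightarrow> slice i z \<in> S"
  shows "continuous_on T (\<lambda>z. f (slice i z))"
  using assms by (intro continuous_on_compose2[OF assms(1) continuous_on_slice]) auto

lemma analytic_image:
  assumes "analytic A" "continuous_on A h"
  shows "analytic (h ` A)"
proof -
  obtain S and f :: "(nat \<Rightarrow> nat) \<Rightarrow> _" where "closed S" "continuous_on S f" "A = f ` S" using assms(1) by (rule analyticE)
  then show ?thesis using assms(2)
    by (intro analyticI[of S "h \<circ> f"] continuous_on_compose) (auto simp: image_comp)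
qed

lemma analytic_Int_closed:
  assumes "analytic A" "closed C"
  shows "analytic (A \<inter> C)"
proof -
  obtain S and f :: "(nat \<Rightarrow> nat) \<Rightarrow> _" where *: "closed S" "continuous_on S f" "A = f ` S" using assms(1) by (rule analyticE)
  show ?thesis
    by (rule analyticI[of "S \<inter> f -` C" f])
      (use * assms(2) in \<open>auto intro: continuous_closed_preimage continuous_on_subset\<close>)
qed

lemma analytic_empty [simp]: "analytic {}"
  by (rule analyticI[of "{}" "\<lambda>_. undefined"]) auto

text \<open>A point of the intersection is coded by one witness for each set. That all witnesses
  have the same image is a closed condition on the code because the space is Hausdorff.\<close>

lemma analytic_INT:
  fixes A :: "nat \<Rightarrow> 'b::t2_space set"
  assumes "\<And>i. analytic (A i)"
  shows "analytic (\<Inter>i. A i)"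
proof -
  have "\<forall>i. \<exists>S (f::(nat \<Rightarrow> nat) \<Rightarrow> 'b). closed S \<and> continuous_on S f \<and> A i = f ` S"
    using assms unfolding analytic_def by blast
  then obtain S and f :: "nat \<Rightarrow> (nat \<Rightarrow> nat) \<Rightarrow> 'b" where *: "\<And>i. closed (S i)" "\<And>i. continuous_on (S i) (f i)" "\<And>i. A i = f i ` S i"
    by metis
  define T where "T = {z. \<forall>i. slice i z \<in> S i}"
  define U where "U = (\<Inter>i. {z\<in>T. f i (slice i z) = f 0 (slice 0 z)})"
  have T: "closed T" unfolding T_def using * by (intro closed_Collect_all closed_slice)
  have ct: "continuous_on T (\<lambda>z. f i (slice i z))" for i
    by (rule continuous_on_comp_slice[OF *(2)]) (auto simp: T_def)
  have "closed U" unfolding U_def by (intro closed_INT ballI closed_eq_on T ct)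
  moreover have "continuous_on U (\<lambda>z. f 0 (slice 0 z))"
    using ct by (rule continuous_on_subset) (auto simp: U_def)
  moreover have "(\<Inter>i. A i) = (\<lambda>z. f 0 (slice 0 z)) ` U"
  proof (intro equalityI subsetI)
    fix x assume x: "x \<in> (\<Inter>i. A i)"
    then have "\<forall>i. \<exists>z. z \<in> S i \<and> x = f i z" using * by auto
    then obtain zs where "\<And>i. zs i \<in> S i" "\<And>i. x = f i (zs i)" by metis
    then show "x \<in> (\<lambda>z. f 0 (slice 0 z)) ` U"
      by (intro image_eqI[of _ _ "merge zs"]) (auto simp: U_def T_def)
  next
    fix x assume "x \<in> (\<lambda>z. f 0 (slice 0 z)) ` U"
    then obtain z where "z \<in> U" "x = f 0 (slice 0 z)" by auto
    moreover from this have "slice i z \<in> S i" "f i (slice i z) = f 0 (slice 0 z)" for i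
      unfolding U_def T_def by blast+
    ultimately have "slice i z \<in> S i \<and> x = f i (slice i z)" for i by metis
    then have "x \<in> A i" for i unfolding *(3) by blast
    then show "x \<in> (\<Inter>i. A i)" by auto
  qed
  ultimately show ?thesis by (rule analyticI)
qed

lemma analytic_Int: "analytic A \<Longrightarrow> analytic B \<Longrightarrow> analytic (A \<inter> (B::'b::t2_space set))"
proof -
  assume "analytic A" "analytic B"
  then have "analytic (\<Inter>i::nat. if i = 0 then A else B)" by (intro analytic_INT) auto
  moreover have "(\<Inter>i::nat. if i = 0 then A else B) = A \<inter> B"
    by (auto simp: set_eq_iff split: if_splits)
  ultimately show ?thesis by simp
qed

text \<open>Slice 0 starts with the index of a set and slice 1 is a witness for that set. The index
  is locally constant, which gives both the closedness of the domain and the continuity of the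
  map.\<close>

lemma analytic_UN:
  fixes A :: "nat \<Rightarrow> 'b::topological_space set"
  assumes "\<And>i. analytic (A i)"
  shows "analytic (\<Union>i. A i)"
proof -
  have "\<forall>i. \<exists>S (f::(nat \<Rightarrow> nat) \<Rightarrow> 'b). closed S \<and> continuous_on S f \<and> A i = f ` S"
    using assms unfolding analytic_def by blast
  then obtain S and f :: "nat \<Rightarrow> (nat \<Rightarrow> nat) \<Rightarrow> 'b" where *: "\<And>i. closed (S i)" "\<And>i. continuous_on (S i) (f i)" "\<And>i. A i = f i ` S i"
    by metis
  define T where "T = {z. slice 1 z \<in> S (slice 0 z 0)}"
  define h where "h z = f (slice 0 z 0) (slice 1 z)" for z
  have "T = (\<Inter>i. {z. slice 0 z \<in> {w. w 0 \<in> - {i}}} \<union> {z. slice 1 z \<in> S i})"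
    unfolding T_def by auto
  moreover have "closed \<dots>"
    by (intro closed_INT ballI closed_Un closed_slice closed_coord *)
  ultimately have "closed T" by simp
  moreover have "continuous_on T h"
    unfolding continuous_on_topological
  proof (intro ballI allI impI)
    fix z B assume z: "z \<in> T" "open B" "h z \<in> B"
    define i where "i = slice 0 z 0"
    have "continuous_on {z. slice 1 z \<in> S i} (\<lambda>z. f i (slice 1 z))"
      by (rule continuous_on_comp_slice[OF *(2)]) auto
    moreover have "slice 1 z \<in> S i" "f i (slice 1 z) \<in> B" using z by (auto simp: T_def h_def i_def)
    ultimately obtain V where V: "open V" "z \<in> V" "\<And>y. slice 1 y \<in> S i \<Longrightarrow> y \<in> V \<Longrightarrow> f i (slice 1 y) \<in> B"
      unfolding continuous_on_topological using z(2) by (smt (verit) mem_Collect_eq)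
    have "open (V \<inter> {z. slice 0 z \<in> {w. w 0 \<in> {i}}})"
      by (intro open_Int V open_slice open_coord)
    then show "\<exists>A. open A \<and> z \<in> A \<and> (\<forall>y\<in>T. y \<in> A \<longrightarrow> h y \<in> B)"
      using V by (intro exI[of _ "V \<inter> {z. slice 0 z \<in> {w. w 0 \<in> {i}}}"]) (auto simp: i_def h_def T_def)
  qed
  moreover have "(\<Union>i. A i) = h ` T"
  proof (intro equalityI subsetI)
    fix x assume "x \<in> (\<Union>i. A i)"
    then obtain i z where "z \<in> S i" "x = f i z" using * by auto
    then show "x \<in> h ` T"
      by (intro image_eqI[of _ _ "merge (\<lambda>k. if k = 0 then (\<lambda>_. i) else z)"]) (simp_all add: h_def T_def)
  next
    fix x assume "x \<in> h ` T"
    then show "x \<in> (\<Union>i. A i)" using * by (auto simp: h_def T_def)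
  qed
  ultimately show ?thesis by (rule analyticI)
qed

lemma analytic_Times:
  fixes A :: "'b::topological_space set" and B :: "'c::topological_space set"
  assumes "analytic A" "analytic B"
  shows "analytic (A \<times> B)"
proof -
  obtain S and f :: "(nat \<Rightarrow> nat) \<Rightarrow> _" where 1: "closed S" "continuous_on S f" "A = f ` S" using assms(1) by (rule analyticE)
  obtain T and g :: "(nat \<Rightarrow> nat) \<Rightarrow> _" where 2: "closed T" "continuous_on T g" "B = g ` T" using assms(2) by (rule analyticE)
  define U where "U = {z. slice 0 z \<in> S} \<inter> {z. slice 1 z \<in> T}"
  show ?thesis
  proof (rule analyticI)
    show "closed U" unfolding U_def using 1 2 by (intro closed_Int closed_slice)
    show "continuous_on U (\<lambda>z. (f (slice 0 z), g (slice 1 z)))"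
      by (intro continuous_on_Pair continuous_on_comp_slice[OF 1(2)] continuous_on_comp_slice[OF 2(2)])
        (auto simp: U_def)
    show "A \<times> B = (\<lambda>z. (f (slice 0 z), g (slice 1 z))) ` U"
    proof (intro equalityI subsetI)
      fix p assume "p \<in> A \<times> B"
      then obtain z w where "z \<in> S" "w \<in> T" "p = (f z, g w)" using 1 2 by auto
      then show "p \<in> (\<lambda>z. (f (slice 0 z), g (slice 1 z))) ` U"
        by (intro image_eqI[of _ _ "merge (\<lambda>k. if k = 0 then z else w)"]) (auto simp: U_def)
    qed (auto simp: U_def 1 2)
  qed
qed

text \<open>Every point is the limit of a sequence in a countable dense set whose
  \<open>n\<close>-th jump is at most \<open>(1/2)^n\<close>. Such sequences form a closed set, and
  the limit is continuous in the sequence because the \<open>N\<close>-th term determines it up to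
  \<open>2 * (1/2)^N\<close>.\<close>

lemma analytic_UNIV: "analytic (UNIV :: 'b::{complete_space, second_countable_topology} set)"
proof -
  obtain D :: "'b set" where D: "countable D" "\<And>X. open X \<Longrightarrow> X \<noteq> {} \<Longrightarrow> \<exists>d\<in>D. d \<in> X"
    using countable_dense_exists by metis
  have "D \<noteq> {}" using D(2)[of UNIV] by auto
  define d where "d = from_nat_into D"
  have dense: "\<exists>n. dist (d n) x < e" if "e > 0" for x e
  proof -
    obtain y where "y \<in> D" "y \<in> ball x e" using D(2)[of "ball x e"] \<open>e > 0\<close> by auto
    then show ?thesis using D(1)
      by (metis d_def dist_commute from_nat_into_to_nat_on mem_ball)
  qed
  define S where "S = {z::nat \<Rightarrow> nat. \<forall>n. dist (d (z n)) (d (z (Suc n))) \<le> (1/2)^n}"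
  have cd: "continuous_on T (\<lambda>z::nat \<Rightarrow> nat. d (z n))" for T n
    by (rule continuous_on_compose2[OF _ continuous_on_coord, of UNIV]) (auto intro: continuous_on_discrete)
  have "closed S" unfolding S_def
    by (intro closed_Collect_all closed_Collect_le continuous_on_dist cd continuous_on_const)
  \<comment> \<open>The bound is the exact sum of the geometric series of \<open>k\<close> jumps;
    the weaker bound without the last factor would not pass through the induction.\<close>
  have *: "dist (d (z n)) (d (z (n + k))) \<le> 2 * (1/2)^n * (1 - (1/2)^k)" if "z \<in> S" for z n k
  proof (induction k)
    case (Suc k)
    have "dist (d (z n)) (d (z (n + Suc k))) \<le> dist (d (z n)) (d (z (n + k))) + dist (d (z (n+k))) (d (z (Suc (n + k))))"
      by (simp add: dist_triangle)
    also have "\<dots> \<le> 2 * (1/2)^n * (1 - (1/2)^k) + (1/2)^(n+k)"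
      using Suc \<open>z \<in> S\<close> by (intro add_mono) (auto simp: S_def)
    also have "\<dots> = 2 * (1/2)^n * (1 - (1/2)^Suc k)" by (simp add: field_simps power_add)
    finally show ?case .
  qed simp
  have bd: "dist (d (z n)) (d (z m)) \<le> 2 * (1/2)^n" if "z \<in> S" "n \<le> m" for z n m
  proof -
    have "2 * (1/2)^n * (1 - (1/2)^(m - n)) \<le> 2 * (1/2)^n * (1::real)"
      by (intro mult_left_mono) auto
    with *[OF that(1), of n "m - n"] have "dist (d (z n)) (d (z (n + (m - n)))) \<le> 2 * (1/2)^n * 1"
      by (rule order_trans)
    then show ?thesis using that(2) by simp
  qed
  define f where "f z = lim (\<lambda>n. d (z n))" for z
  have lim: "(\<lambda>n. d (z n)) \<longlonglongrightarrow> f z" if "z \<in> S" for z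
  proof -
    have "Cauchy (\<lambda>n. d (z n))"
    proof (rule metric_CauchyI)
      fix e :: real assume "e > 0"
      then obtain N where N: "(1/2)^N < e/4" using real_arch_pow_inv[of "e/4" "1/2"] by auto
      show "\<exists>M. \<forall>m\<ge>M. \<forall>n\<ge>M. dist (d (z m)) (d (z n)) < e"
      proof (intro exI allI impI)
        fix m n assume "m \<ge> N" "n \<ge> N"
        then have "dist (d (z m)) (d (z n)) \<le> 2 * (1/2)^N + 2 * (1/2)^N"
          using bd[OF that, of N m] bd[OF that, of N n] dist_triangle2[of "d (z m)" "d (z n)" "d (z N)"]
          by (simp add: dist_commute)
        then show "dist (d (z m)) (d (z n)) < e" using N by linarith
      qed
    qed
    then show ?thesis unfolding f_def using Cauchy_convergent_iff convergent_LIMSEQ_iff by blast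
  qed
  have bdl: "dist (d (z n)) (f z) \<le> 2 * (1/2)^n" if "z \<in> S" for z n
    by (rule Lim_bounded[OF tendsto_dist[OF tendsto_const lim[OF that]], of n]) (use bd[OF that] in auto)
  have "continuous_on S f"
    unfolding continuous_on_topological
  proof (intro ballI allI impI)
    fix z B assume z: "z \<in> S" "open B" "f z \<in> B"
    obtain e where e: "e > 0" "ball (f z) e \<subseteq> B" using z(2,3) open_contains_ball by metis
    obtain N where N: "(1/2)^N < e/4" using real_arch_pow_inv[of "e/4" "1/2"] e by auto
    have "f y \<in> B" if "y \<in> S" "y N \<in> {z N}" for y
    proof -
      have "dist (f z) (f y) \<le> 2 * (1/2)^N + 2 * (1/2)^N"
        using bdl[OF z(1), of N] bdl[OF that(1), of N] that(2) dist_triangle3[of "f z" "f y" "d (z N)"]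
        by simp
      then show ?thesis using N e by (auto simp: subset_iff)
    qed
    then show "\<exists>A. open A \<and> z \<in> A \<and> (\<forall>y\<in>S. y \<in> A \<longrightarrow> f y \<in> B)"
      by (intro exI[of _ "{y. y N \<in> {z N}}"] conjI open_coord) auto
  qed
  moreover have "UNIV = f ` S"
  proof -
    have "x \<in> f ` S" for x
    proof -
      \<comment> \<open>Approximating within a quarter of the allowed jump keeps consecutive terms
        close enough for \<open>S\<close>.\<close>
      have "\<forall>n. \<exists>k. dist (d k) x < (1/2)^n / 4" by (intro allI dense) simp
      then obtain z where z: "\<And>n. dist (d (z n)) x < (1/2)^n / 4" by metis
      have "z \<in> S" unfolding S_def
      proof (intro CollectI allI)
        fix n
        have "dist (d (z n)) (d (z (Suc n))) \<le> (1/2)^n / 4 + (1/2)^Suc n / 4"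
          using z[of n] z[of "Suc n"] dist_triangle2[of "d (z n)" "d (z (Suc n))" x] by linarith
        also have "\<dots> \<le> (1/2)^n" by simp
        finally show "dist (d (z n)) (d (z (Suc n))) \<le> (1/2)^n" .
      qed
      have "(\<lambda>n. d (z n)) \<longlonglongrightarrow> x"
      proof (rule metric_LIMSEQ_I)
        fix e :: real assume "e > 0"
        then obtain N where N: "(1/2)^N < e" using real_arch_pow_inv[of "e" "1/2"] by auto
        show "\<exists>no. \<forall>n\<ge>no. dist (d (z n)) x < e"
        proof (intro exI allI impI)
          fix n assume "n \<ge> N"
          have "(1/2::real)^n \<le> (1/2)^N" using \<open>n \<ge> N\<close> by (intro power_decreasing) auto
          then show "dist (d (z n)) x < e" using z[of n] N zero_le_dist[of "d (z n)" x] by linarith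
        qed
      qed
      then have "f z = x" using lim[OF \<open>z \<in> S\<close>] LIMSEQ_unique by blast
      then show ?thesis using \<open>z \<in> S\<close> by auto
    qed
    then show ?thesis by auto
  qed
  ultimately show ?thesis by (rule analyticI[OF \<open>closed S\<close>])
qed

lemma analytic_closed: "closed C \<Longrightarrow> analytic (C :: 'b::{complete_space, second_countable_topology} set)"
  using analytic_Int_closed[OF analytic_UNIV, of C] by simp

lemma analytic_open:
  assumes "open (O' :: 'b::{complete_space, second_countable_topology} set)"
  shows "analytic O'"
proof (cases "O' = UNIV")
  \<comment> \<open>\<open>infdist\<close> to the empty set is 0, so the whole space has to be
    treated apart.\<close>
  case False
  have "O' = (\<Union>n. {x. 1 / Suc n \<le> infdist x (- O')})"
  proof (intro equalityI subsetI)
    fix x assume "x \<in> O'"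
    then have "infdist x (- O') > 0"
      using in_closed_iff_infdist_zero[of "- O'" x] assms False infdist_nonneg[of x "- O'"]
      by (auto simp: order_le_less closed_Compl)
    then obtain n where "1 / Suc n < infdist x (- O')" by (metis reals_Archimedean inverse_eq_divide)
    then show "x \<in> (\<Union>n. {x. 1 / Suc n \<le> infdist x (- O')})" by (intro UN_I[of n]) auto
  next
    fix x assume "x \<in> (\<Union>n. {x. 1 / Suc n \<le> infdist x (- O')})"
    then obtain n where "1 / real (Suc n) \<le> infdist x (- O')" by blast
    moreover have "0 < 1 / real (Suc n)" by simp
    ultimately have "infdist x (- O') \<noteq> 0" by linarith
    then show "x \<in> O'" using infdist_zero[of x "- O'"] by blast
  qed
  moreover have "analytic (\<Union>n. {x. 1 / Suc n \<le> infdist x (- O')})"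
    by (intro analytic_UN analytic_closed closed_Collect_le continuous_intros)
  ultimately show ?thesis by simp
qed (simp add: analytic_UNIV)

lemma analytic_borel:
  assumes "B \<in> sets (borel :: 'b::{complete_space, second_countable_topology} measure)"
  shows "analytic B"
proof -
  have "B \<in> sigma_sets UNIV {S. open S}" using assms by (simp add: borel_def)
  \<comment> \<open>Complements of analytic sets need not be analytic, so the induction carries the
    complement along.\<close>
  then have "analytic B \<and> analytic (- B)"
  proof induction
    case (Basic a)
    then show ?case by (auto intro: analytic_open analytic_closed)
  next
    case Empty
    then show ?case by (simp add: analytic_UNIV)
  next
    case (Compl a)
    then show ?case by (simp add: Compl_eq_Diff_UNIV[symmetric])
  next
    case (Union a)
    then show ?case by (auto intro!: analytic_UN analytic_INT)
  qed
  then show ?thesis ..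
qed

text \<open>The graph of a Borel map is Borel, being the preimage of the diagonal, and the image of
  \<open>A\<close> is the projection of the part of the graph above \<open>A\<close>.\<close>

lemma analytic_borel_image:
  fixes h :: "'b::{complete_space, second_countable_topology} \<Rightarrow> 'c::{complete_space, second_countable_topology}"
  assumes "analytic A" "h \<in> borel \<rightarrow>\<^sub>M borel"
  shows "analytic (h ` A)"
proof -
  have "{p. h (fst p) = snd p} \<in> sets (borel :: ('b \<times> 'c) measure)"
  proof -
    have "(\<lambda>p. (h (fst p), snd p)) \<in> (borel :: ('b \<times> 'c) measure) \<rightarrow>\<^sub>M (borel :: ('c \<times> 'c) measure)"
      unfolding borel_prod[symmetric] using assms(2) by measurable
    moreover have "{p :: 'c \<times> 'c. \<exists>x. p = (x, x)} \<in> sets borel"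
      by (simp add: closed_diagonal)
    ultimately have "(\<lambda>p. (h (fst p), snd p)) -` {p :: 'c \<times> 'c. \<exists>x. p = (x, x)} \<inter> space borel
      \<in> sets (borel :: ('b \<times> 'c) measure)"
      by (rule measurable_sets)
    also have "(\<lambda>p. (h (fst p), snd p)) -` {p :: 'c \<times> 'c. \<exists>x. p = (x, x)} \<inter> space borel
      = {p. h (fst p) = snd p}" by auto
    finally show ?thesis .
  qed
  then have "analytic ({p. h (fst p) = snd p} \<inter> (A \<times> UNIV))"
    by (intro analytic_Int analytic_Times assms analytic_UNIV analytic_borel)
  then have "analytic (snd ` ({p. h (fst p) = snd p} \<inter> (A \<times> UNIV)))"
    by (rule analytic_image) (intro continuous_intros)
  moreover have "snd ` ({p. h (fst p) = snd p} \<inter> (A \<times> UNIV)) = h ` A" by force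
  ultimately show ?thesis by simp
qed

section \<open>Separation of analytic sets\<close>

definition cyl :: "nat list \<Rightarrow> (nat \<Rightarrow> nat) set" where
  "cyl u = {z. \<forall>i<length u. z i = u ! i}"

lemma cyl_Nil [simp]: "cyl [] = UNIV"
  by (simp add: cyl_def)

lemma cyl_snoc: "z \<in> cyl (u @ [n]) \<longleftrightarrow> z \<in> cyl u \<and> z (length u) = n"
  by (auto simp: cyl_def nth_append less_Suc_eq)

lemma closed_cyl: "closed (cyl u)"
proof -
  have "cyl u = {z. \<forall>i. z i \<in> (if i < length u then {u ! i} else UNIV)}" by (auto simp: cyl_def)
  then show ?thesis by (simp only:) (intro closed_Collect_all closed_coord)
qed

lemma cyl_basis:
  assumes "open V" "z \<in> V"
  obtains n where "cyl (map z [0..<n]) \<subseteq> V"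
proof -
  have "openin (product_topology (\<lambda>i::nat. euclidean::nat topology) UNIV) V"
    using assms(1) by (simp add: open_fun_def)
  then obtain X where X: "z \<in> Pi\<^sub>E UNIV X" "finite {i. X i \<noteq> UNIV}" "Pi\<^sub>E UNIV X \<subseteq> V"
    using product_topology_open_contains_basis[OF _ assms(2)] by force
  obtain n where n: "\<And>i. X i \<noteq> UNIV \<Longrightarrow> i < n"
    using X(2) by (metis (mono_tags) finite_nat_set_iff_bounded mem_Collect_eq)
  have "cyl (map z [0..<n]) \<subseteq> Pi\<^sub>E UNIV X"
  proof
    fix y assume y: "y \<in> cyl (map z [0..<n])"
    have "y i \<in> X i" for i
    proof (cases "i < n")
      case True
      then have "y i = z i" using y by (simp add: cyl_def)
      then show ?thesis using X(1) by (simp add: PiE_iff)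
    next
      case False
      then show ?thesis using n by blast
    qed
    then show "y \<in> Pi\<^sub>E UNIV X" by (simp add: PiE_iff)
  qed
  then show thesis by (rule that[OF subset_trans[OF _ X(3)]])
qed

lemma closed_limit_cyl:
  assumes "closed S" "\<And>n. S \<inter> cyl (map z [0..<n]) \<noteq> {}"
  shows "z \<in> S"
proof (rule ccontr)
  assume "z \<notin> S"
  then obtain n where "cyl (map z [0..<n]) \<subseteq> - S"
    using cyl_basis[of "- S" z] assms(1) by (auto simp: closed_def)
  then show False using assms(2)[of n] by blast
qed

lemma branch_exists:
  assumes "P []" "\<And>u. P u \<Longrightarrow> \<exists>n. P (u @ [n])"
  obtains z :: "nat \<Rightarrow> 'x" where "\<And>n. P (map z [0..<n])"
proof -
  obtain s where s: "\<And>n. P (s n)" "\<And>n. \<exists>k. s (Suc n) = s n @ [k]" "s 0 = []"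
  proof -
    have "\<exists>s. \<forall>n. (P (s n) \<and> (n = 0 \<longrightarrow> s n = [])) \<and> (\<exists>k. s (Suc n) = s n @ [k])"
      using assms by (intro dependent_nat_choice) auto
    then show ?thesis using that by blast
  qed
  obtain z where z: "\<And>n. s (Suc n) = s n @ [z n]" using s(2) by metis
  have "s n = map z [0..<n]" for n by (induction n) (auto simp: s(3) z)
  then show ?thesis using s(1) that[of z] by metis
qed

lemma slice_upd: "fst (prod_decode p) \<noteq> i \<Longrightarrow> slice i (y(p := n)) = slice i y"
  by (auto simp: slice_def fun_eq_iff)

lemma cyl_upd: "y \<in> cyl u \<Longrightarrow> y(length u := n) \<in> cyl (u @ [n])"
  by (auto simp: cyl_def nth_append)

text \<open>Here \<open>q i w\<close>, for \<open>w \<in> L i\<close>, is the entry at \<open>i\<close> of the sequence coded by \<open>w\<close>. As in Lusin's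
  theorem, a failure of separation propagates to smaller cylinders and would in the limit
  produce a sequence with all entries in \<open>f ` S\<close>; slice \<open>0\<close> of the branch codes the sequence and
  slice \<open>i + 1\<close> a witness for its entry at \<open>i\<close>.\<close>

lemma separation:
  fixes f :: "(nat \<Rightarrow> nat) \<Rightarrow> 'a::t2_space" and q :: "nat \<Rightarrow> (nat \<Rightarrow> nat) \<Rightarrow> 'a"
  assumes S: "closed S" "continuous_on S f" and S': "closed S'"
    and L: "\<And>i. open (L i)" "\<And>i. continuous_on (S' \<inter> L i) (q i)"
    and disj: "\<And>w. w \<in> S' \<Longrightarrow> \<exists>i. w \<in> L i \<and> q i w \<notin> f ` S"
  shows "\<exists>B\<in>sets borel. f ` S \<subseteq> B \<and> (\<forall>w\<in>S'. \<exists>i. w \<in> L i \<and> q i w \<notin> B)"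
proof -
  \<comment> \<open>Witnesses for different entries occupy different slices, so each index keeps its
    own Borel set \<open>B i\<close> until the end.\<close>
  define good where "good u \<longleftrightarrow> (\<exists>B. 
      (\<forall>i. B i \<in> sets borel \<and> (\<forall>y\<in>cyl u. slice (Suc i) y \<in> S \<longrightarrow> f (slice (Suc i) y) \<in> B i)) \<and>
      (\<forall>y\<in>cyl u. slice 0 y \<in> S' \<longrightarrow> (\<exists>i. slice 0 y \<in> L i \<and> q i (slice 0 y) \<notin> B i)))" for u
  have step: "good u" if all: "\<And>n. good (u @ [n])" for u
  proof -
    from all have "\<forall>n. \<exists>B. 
      (\<forall>i. B i \<in> sets borel \<and> (\<forall>y\<in>cyl (u @ [n]). slice (Suc i) y \<in> S \<longrightarrow> f (slice (Suc i) y) \<in> B i)) \<and>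
      (\<forall>y\<in>cyl (u @ [n]). slice 0 y \<in> S' \<longrightarrow> (\<exists>i. slice 0 y \<in> L i \<and> q i (slice 0 y) \<notin> B i))"
      unfolding good_def by blast
    then obtain B where B1: "\<And>n i. B n i \<in> sets borel"
      and B2: "\<And>n i y. y \<in> cyl (u @ [n]) \<Longrightarrow> slice (Suc i) y \<in> S \<Longrightarrow> f (slice (Suc i) y) \<in> B n i"
      and B3: "\<And>n y. y \<in> cyl (u @ [n]) \<Longrightarrow> slice 0 y \<in> S' \<Longrightarrow> \<exists>i. slice 0 y \<in> L i \<and> q i (slice 0 y) \<notin> B n i"
      by metis
    define k where "k = fst (prod_decode (length u))"
    \<comment> \<open>Extending \<open>u\<close> fixes one more value of slice \<open>k\<close>
      only. If \<open>k\<close> holds the witnesses for index \<open>i\<close>, the union over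
      \<open>n\<close> encloses them whatever that value is; at the other indices the witness is
      unaffected and lies in all \<open>B n i\<close>. The sequence still omits an entry: either
      some \<open>B n\<close> omits one at another index, and then so does the intersection, or
      every \<open>B n\<close> omits the one at index \<open>i\<close>, and then so does the
      union.\<close>
    define B' where "B' i = (if Suc i = k then \<Union>n. B n i else \<Inter>n. B n i)" for i
    have own: "y \<in> cyl (u @ [y (length u)])" if "y \<in> cyl u" for y
      using that by (simp add: cyl_snoc)
    have "B' i \<in> sets borel" for i
      unfolding B'_def using B1 by (auto intro!: sets.countable_UN sets.countable_INT)
    moreover have "f (slice (Suc i) y) \<in> B' i" if y: "y \<in> cyl u" "slice (Suc i) y \<in> S" for i y
    proof (cases "Suc i = k")
      case True
      then show ?thesis using B2[OF own[OF y(1)] y(2)] by (auto simp: B'_def)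
    next
      case False
      then have "slice (Suc i) (y(length u := n)) = slice (Suc i) y" for n
        by (intro slice_upd) (auto simp: k_def)
      then have "f (slice (Suc i) y) \<in> B n i" for n
        using B2[OF cyl_upd[OF y(1), of n], of i] y(2) by simp
      then show ?thesis using False by (simp add: B'_def)
    qed
    moreover have "\<exists>i. slice 0 y \<in> L i \<and> q i (slice 0 y) \<notin> B' i" if y: "y \<in> cyl u" "slice 0 y \<in> S'" for y
    proof (cases "k = 0")
      case True
      then show ?thesis using B3[OF own[OF y(1)] y(2)] by (auto simp: B'_def)
    next
      case False
      then have "slice 0 (y(length u := n)) = slice 0 y" for n
        by (intro slice_upd) (auto simp: k_def)
      then have ex: "\<exists>i. slice 0 y \<in> L i \<and> q i (slice 0 y) \<notin> B n i" for n
        using B3[OF cyl_upd[OF y(1), of n]] y(2) by simp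
      show ?thesis
      proof (cases "\<exists>n i. slice 0 y \<in> L i \<and> q i (slice 0 y) \<notin> B n i \<and> Suc i \<noteq> k")
        case True
        then show ?thesis by (auto simp: B'_def)
      next
        case c: False
        obtain i where i: "k = Suc i" using False by (cases k) auto
        have "slice 0 y \<in> L i \<and> q i (slice 0 y) \<notin> B n i" for n
          using ex[of n] c i by auto
        then show ?thesis using i by (auto simp: B'_def)
      qed
    qed
    ultimately show ?thesis unfolding good_def by (intro exI[of _ B']) blast
  qed
  have "good []"
  proof (rule ccontr)
    assume "\<not> good []"
    then obtain z where z: "\<And>n. \<not> good (map z [0..<n])"
      using branch_exists[of "\<lambda>u. \<not> good u"] step by blast
    define w where "w = slice 0 z"
    have "\<exists>n. good (map z [0..<n])"
    proof (cases "w \<in> S'")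
      case False
      have "open {z. slice 0 z \<in> - S'}" using S' by (intro open_slice) (simp add: closed_def)
      then obtain n where n: "cyl (map z [0..<n]) \<subseteq> {z. slice 0 z \<in> - S'}"
        using cyl_basis[of _ z] False w_def by blast
      then have "good (map z [0..<n])"
        unfolding good_def by (intro exI[of _ "\<lambda>_. UNIV"]) auto
      then show ?thesis ..
    next
      case True
      then obtain i where i: "w \<in> L i" "q i w \<notin> f ` S" using disj by blast
      \<comment> \<open>If the witness slice is outside \<open>S\<close>, nothing near it has to be
        enclosed and \<open>B0\<close> is empty; otherwise the two distinct values are separated by
        open sets and continuity supplies \<open>V\<close> and \<open>W\<close>.\<close>
      obtain B0 V W where B0: "open B0" "open V" "open W" "slice (Suc i) z \<in> V" "w \<in> W" "W \<subseteq> L i"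
        "\<And>y. y \<in> S \<Longrightarrow> y \<in> V \<Longrightarrow> f y \<in> B0" "\<And>y. y \<in> S' \<Longrightarrow> y \<in> W \<Longrightarrow> q i y \<notin> B0"
      proof (cases "slice (Suc i) z \<in> S")
        case False
        then show ?thesis using that[of "{}" "- S" "L i"] i L S by (auto simp: closed_def)
      next
        case zS: True
        then have "f (slice (Suc i) z) \<noteq> q i w" using i(2) by (metis imageI)
        from hausdorff[OF this] obtain O1 O2
          where O': "open O1" "open O2" "f (slice (Suc i) z) \<in> O1" "q i w \<in> O2" "O1 \<inter> O2 = {}"
          by blast
        obtain V where V: "open V" "slice (Suc i) z \<in> V" "\<forall>y\<in>S. y \<in> V \<longrightarrow> f y \<in> O1"
          using S(2)[unfolded continuous_on_topological, rule_format, OF zS O'(1,3)] by blast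
        have "w \<in> S' \<inter> L i" using True i by simp
        then obtain W where W: "open W" "w \<in> W" "\<forall>y\<in>S' \<inter> L i. y \<in> W \<longrightarrow> q i y \<in> O2"
          using L(2)[of i, unfolded continuous_on_topological, rule_format, OF _ O'(2,4)] by blast
        show ?thesis
          by (rule that[of O1 V "W \<inter> L i"]) (use O' V W L(1) i(1) in \<open>auto 0 3\<close>)
      qed
      have "open ({z. slice (Suc i) z \<in> V} \<inter> {z. slice 0 z \<in> W})"
        using B0 by (intro open_Int open_slice)
      then obtain n where n: "cyl (map z [0..<n]) \<subseteq> {z. slice (Suc i) z \<in> V} \<inter> {z. slice 0 z \<in> W}"
        using cyl_basis[of _ z] B0(4,5) w_def by blast
      have "good (map z [0..<n])"
        unfolding good_def
      proof (intro exI[of _ "\<lambda>j. if j = i then B0 else UNIV"] conjI ballI allI impI)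
        show "(if j = i then B0 else UNIV) \<in> sets borel" for j using B0(1) by simp
        show "f (slice (Suc j) y) \<in> (if j = i then B0 else UNIV)"
          if "y \<in> cyl (map z [0..<n])" "slice (Suc j) y \<in> S" for j y
          using B0(7) that n by auto
        show "\<exists>j. slice 0 y \<in> L j \<and> q j (slice 0 y) \<notin> (if j = i then B0 else UNIV)"
          if "y \<in> cyl (map z [0..<n])" "slice 0 y \<in> S'" for y
          using B0(6,8) that n by (intro exI[of _ i]) auto
      qed
      then show ?thesis ..
    qed
    then show False using z by blast
  qed
  then obtain B where B1: "\<And>i. B i \<in> sets borel"
    and B2: "\<And>i y. slice (Suc i) y \<in> S \<Longrightarrow> f (slice (Suc i) y) \<in> B i"
    and B3: "\<And>y. slice 0 y \<in> S' \<Longrightarrow> \<exists>i. slice 0 y \<in> L i \<and> q i (slice 0 y) \<notin> B i"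
    unfolding good_def by auto
  \<comment> \<open>Without restrictions from \<open>u\<close>, the slices range over everything
    independently, so each \<open>B i\<close> alone contains the whole image and the family can be
    replaced by its intersection.\<close>
  show ?thesis
  proof (intro bexI[of _ "\<Inter>i. B i"] conjI ballI)
    show "(\<Inter>i. B i) \<in> sets borel" using B1 by (intro sets.countable_INT) auto
    show "f ` S \<subseteq> (\<Inter>i. B i)"
      using B2[of _ "merge (\<lambda>_. z)" for z] by auto
    show "\<exists>i. w \<in> L i \<and> q i w \<notin> (\<Inter>i. B i)" if "w \<in> S'" for w
      using B3[of "merge (\<lambda>_. w)"] that by auto
  qed
qed

text \<open>The case of \<open>separation\<close> in which every entry of the sequence coded by
  \<open>w\<close> is \<open>g w\<close>.\<close>

lemma lusin_separation:
  fixes A F :: "'a::t2_space set"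
  assumes "analytic A" "analytic F" "A \<inter> F = {}"
  shows "\<exists>B\<in>sets borel. A \<subseteq> B \<and> B \<inter> F = {}"
proof -
  obtain S and f :: "(nat \<Rightarrow> nat) \<Rightarrow> 'a" where 1: "closed S" "continuous_on S f" "A = f ` S"
    using assms(1) by (rule analyticE)
  obtain T and g :: "(nat \<Rightarrow> nat) \<Rightarrow> 'a" where 2: "closed T" "continuous_on T g" "F = g ` T"
    using assms(2) by (rule analyticE)
  have "\<exists>B\<in>sets borel. f ` S \<subseteq> B \<and> (\<forall>w\<in>T. \<exists>i::nat. w \<in> UNIV \<and> g w \<notin> B)"
    using 1 2 assms(3) by (intro separation) auto
  then show ?thesis using 1 2 by auto
qed

section \<open>Analytic hypergraphs: anticlique hulls and vertex sets\<close>

text \<open>In the sum topology the length is locally constant, so having an \<open>i\<close>-th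
  entry is a clopen condition on codes of edges, and the entry is continuous where it
  exists.\<close>

lemma analytic_edges:
  fixes G :: "'a::topological_space edge set"
  assumes "analytic_in seq_space G" "G \<noteq> {}"
  obtains g :: "(nat \<Rightarrow> nat) \<Rightarrow> 'a edge" where "G = range g" "range g \<subseteq> seqs UNIV"
    "\<And>i. open {w. enat i < fst (g w)}" "\<And>i. closed {w. enat i < fst (g w)}"
    "\<And>i. continuous_on {w. enat i < fst (g w)} (\<lambda>w. snd (g w) i)"
proof -
  obtain g :: "(nat \<Rightarrow> nat) \<Rightarrow> 'a edge" where g: "continuous_map euclidean seq_space g" "G = range g"
    using assms unfolding analytic_in_def by blast
  have sub: "range g \<subseteq> seqs UNIV"
    using continuous_map_image_subset_topspace[OF g(1)] by (simp add: topspace_seq_space)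
  have pre: "open {w. g w \<in> U}" if "openin seq_space U" for U
    using openin_continuous_map_preimage[OF g(1) that] by simp
  have o1: "openin seq_space {e \<in> seqs (UNIV::'a set). P (fst e)}" (is "openin _ ?U") for P
  proof -
    have *: "{x. (n, x) \<in> {e \<in> seqs (UNIV::'a set). P (fst e)}} = 
      (if P n then topspace (product_topology (\<lambda>_. euclidean) {i. enat i < n}) else {})" for n
      by (auto simp: seqs_def)
    have pieces: "openin (product_topology (\<lambda>_. euclidean) {i. enat i < n}) {x. (n, x) \<in> {e \<in> seqs (UNIV::'a set). P (fst e)}}" for n
      unfolding * by (cases "P n") (simp_all only: openin_topspace openin_empty if_True if_False)
    then show ?thesis unfolding seq_space_def openin_sum_topology
    proof (intro conjI ballI)
      show "?U \<subseteq> Sigma UNIV (topspace \<circ> (\<lambda>n. product_topology (\<lambda>_. euclidean) {i. enat i < n}))"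
        by (auto simp: seqs_def)
    qed (rule pieces)
  qed
  have o2: "openin seq_space {e \<in> seqs UNIV. enat i < fst e \<and> snd e i \<in> V}" (is "openin _ ?U") if "open V" for i and V :: "'a set"
  proof -
    have *: "{x. (n, x) \<in> {e \<in> seqs UNIV. enat i < fst e \<and> snd e i \<in> V}} = (if enat i < n then 
      {x \<in> topspace (product_topology (\<lambda>_. euclidean) {i. enat i < n}). x i \<in> V} else {})" for n
      by (auto simp: seqs_def)
    have pieces: "openin (product_topology (\<lambda>_. euclidean) {i. enat i < n}) {x. (n, x) \<in> {e \<in> seqs UNIV. enat i < fst e \<and> snd e i \<in> V}}" for n
    proof (cases "enat i < n")
      case True
      then have "continuous_map (product_topology (\<lambda>_. euclidean) {i. enat i < n}) euclidean (\<lambda>x::nat\<Rightarrow>'a. x i)"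
        by (intro continuous_map_product_projection) simp
      from openin_continuous_map_preimage[OF this, of V] that show ?thesis
        unfolding * using True by simp
    qed (simp add: *)
    then show ?thesis unfolding seq_space_def openin_sum_topology
    proof (intro conjI ballI)
      show "?U \<subseteq> Sigma UNIV (topspace \<circ> (\<lambda>n. product_topology (\<lambda>_. euclidean) {i. enat i < n}))"
        by (auto simp: seqs_def)
    qed (rule pieces)
  qed
  show thesis
  proof (rule that[of g])
    show "open {w. enat i < fst (g w)}" for i
      using pre[OF o1[of "\<lambda>n. enat i < n"]] sub by (simp add: image_subset_iff)
    show "closed {w. enat i < fst (g w)}" for i
    proof -
      have "- {w. enat i < fst (g w)} = {w. g w \<in> {e \<in> seqs UNIV. \<not> enat i < fst e}}"
        using sub by blast
      then show ?thesis unfolding closed_def using pre[OF o1[of "\<lambda>n. \<not> enat i < n"]] by simp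
    qed
    show "continuous_on {w. enat i < fst (g w)} (\<lambda>w. snd (g w) i)" for i
      unfolding continuous_on_topological
    proof (intro ballI allI impI)
      fix w B assume w: "w \<in> {w. enat i < fst (g w)}" "open B" "snd (g w) i \<in> B"
      show "\<exists>A. open A \<and> w \<in> A \<and> (\<forall>y\<in>{w. enat i < fst (g w)}. y \<in> A \<longrightarrow> snd (g y) i \<in> B)"
      proof (intro exI conjI ballI impI)
        show "open {w. g w \<in> {e \<in> seqs UNIV. enat i < fst e \<and> snd e i \<in> B}}"
          by (rule pre[OF o2[OF w(2)]])
        show "w \<in> {w. g w \<in> {e \<in> seqs UNIV. enat i < fst e \<and> snd e i \<in> B}}"
          using w sub by (simp add: image_subset_iff)
      qed simp
    qed
  qed (use g sub in auto)
qed

lemma analytic_in_subset_seqs: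
  fixes G :: "'a::topological_space edge set"
  assumes "analytic_in seq_space G"
  shows "G \<subseteq> seqs UNIV"
proof (cases "G = {}")
  case False
  from analytic_edges[OF assms this] show ?thesis by metis
qed simp

lemma rng_conv: "rng e = {snd e i | i. enat i < fst e}"
  by (auto simp: rng_def)

text \<open>A set is an anticlique iff every edge has an entry outside it. With \<open>w\<close>
  coding an edge and \<open>L i\<close> the codes of edges that have an \<open>i\<close>-th entry,
  this is exactly the disjointness hypothesis of \<open>separation\<close>.\<close>

lemma analytic_anticlique_hull:
  fixes A :: "'a::t2_space set"
  assumes G: "analytic_in seq_space G" and A: "analytic A" and ac: "anticlique G A"
  shows "\<exists>B\<in>sets borel. A \<subseteq> B \<and> anticlique G B"
proof (cases "G = {}")
  case True
  then show ?thesis by (intro bexI[of _ UNIV]) (auto simp: anticlique_def)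
next
  case False
  then obtain g :: "(nat \<Rightarrow> nat) \<Rightarrow> 'a edge" where g: "G = range g" "range g \<subseteq> seqs UNIV"
    "\<And>i. open {w. enat i < fst (g w)}"
    "\<And>i. continuous_on {w. enat i < fst (g w)} (\<lambda>w. snd (g w) i)"
    using analytic_edges[OF G] by metis
  have ac_iff: "anticlique G B \<longleftrightarrow> (\<forall>w. \<exists>i. enat i < fst (g w) \<and> snd (g w) i \<notin> B)" for B
  proof -
    have "g w \<in> seqs B \<longleftrightarrow> (\<forall>i. enat i < fst (g w) \<longrightarrow> snd (g w) i \<in> B)" for w
      using seqs_iff_rng[of "g w" B] g(2) by (auto simp: rng_conv)
    then have "g w \<notin> seqs B \<longleftrightarrow> (\<exists>i. enat i < fst (g w) \<and> snd (g w) i \<notin> B)" for w by blast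
    moreover have "anticlique G B \<longleftrightarrow> (\<forall>w. g w \<notin> seqs B)" unfolding anticlique_def g(1) by blast
    ultimately show ?thesis by simp
  qed
  obtain S and f :: "(nat \<Rightarrow> nat) \<Rightarrow> 'a" where 1: "closed S" "continuous_on S f" "A = f ` S"
    using A by (rule analyticE)
  have "\<exists>B\<in>sets borel. f ` S \<subseteq> B \<and> (\<forall>w\<in>UNIV. \<exists>i. w \<in> {w. enat i < fst (g w)} \<and> snd (g w) i \<notin> B)"
    by (rule separation[OF 1(1,2)]) (use ac g(3,4) in \<open>auto simp: ac_iff 1(3)\<close>)
  then show ?thesis unfolding ac_iff 1(3) by simp
qed

definition verts :: "'a edge set \<Rightarrow> 'a set \<Rightarrow> 'a set" where
  "verts G E = {x. \<exists>e\<in>G. rng e \<subseteq> E \<and> x \<in> rng e}"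

text \<open>Slice 0 codes an edge and slice \<open>j + 1\<close> a witness that its entry at
  \<open>j\<close> lies in \<open>E\<close>. The constraint \<open>K j\<close> applies only if that
  entry exists; it is closed because existence is clopen.\<close>

lemma analytic_verts:
  fixes E :: "'a::t2_space set"
  assumes G: "analytic_in seq_space G" and E: "analytic E"
  shows "analytic (verts G E)"
proof (cases "G = {}")
  case False
  then obtain g :: "(nat \<Rightarrow> nat) \<Rightarrow> 'a edge" where g: "G = range g" "range g \<subseteq> seqs UNIV"
    "\<And>i. open {w. enat i < fst (g w)}" "\<And>i. closed {w. enat i < fst (g w)}"
    "\<And>i. continuous_on {w. enat i < fst (g w)} (\<lambda>w. snd (g w) i)"
    using analytic_edges[OF G] by metis
  obtain S and f :: "(nat \<Rightarrow> nat) \<Rightarrow> 'a" where 1: "closed S" "continuous_on S f" "E = f ` S"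
    using E by (rule analyticE)
  define L where "L i = {w. enat i < fst (g w)}" for i
  define q where "q i w = snd (g w) i" for i w
  have L: "open (L i)" "closed (L i)" "continuous_on (L i) (q i)" for i
    using g(3-5) by (auto simp: L_def q_def)
  define T where "T j = {z. slice 0 z \<in> L j} \<inter> {z. slice (Suc j) z \<in> S}" for j
  define K where "K j = {z. slice 0 z \<in> - L j} \<union> {z\<in>T j. f (slice (Suc j) z) = q j (slice 0 z)}" for j
  define U where "U i = {z. slice 0 z \<in> L i} \<inter> (\<Inter>j. K j)" for i
  have "closed (T j)" for j unfolding T_def using L 1 by (intro closed_Int closed_slice)
  moreover have "continuous_on (T j) (\<lambda>z. f (slice (Suc j) z))" "continuous_on (T j) (\<lambda>z. q j (slice 0 z))" for j
    by (intro continuous_on_comp_slice[OF 1(2)] continuous_on_comp_slice[OF L(3)], simp add: T_def)+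
  ultimately have "closed (K j)" for j
    unfolding K_def using L(1) by (intro closed_Un closed_eq_on closed_slice) auto
  then have cU: "closed (U i)" for i
    unfolding U_def using L by (intro closed_Int closed_INT closed_slice) auto
  have qU: "continuous_on (U i) (\<lambda>z. q i (slice 0 z))" for i
    by (rule continuous_on_comp_slice[OF L(3)]) (simp add: U_def)
  have "analytic (\<Union>i. (\<lambda>z. q i (slice 0 z)) ` U i)"
    by (intro analytic_UN analyticI[OF cU qU refl])
  also have "(\<Union>i. (\<lambda>z. q i (slice 0 z)) ` U i) = verts G E"
  proof (intro equalityI subsetI)
    fix x assume "x \<in> (\<Union>i. (\<lambda>z. q i (slice 0 z)) ` U i)"
    then obtain i z where z: "z \<in> U i" "x = q i (slice 0 z)" by blast
    have "rng (g (slice 0 z)) \<subseteq> E"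
    proof
      fix y assume "y \<in> rng (g (slice 0 z))"
      then obtain j where "slice 0 z \<in> L j" "y = q j (slice 0 z)" by (auto simp: rng_conv L_def q_def)
      moreover have "z \<in> K j" using z(1) by (auto simp: U_def)
      ultimately have "z \<in> T j" "y = f (slice (Suc j) z)" by (auto simp: K_def)
      then show "y \<in> E" unfolding 1(3) by (auto simp: T_def)
    qed
    moreover have "x \<in> rng (g (slice 0 z))" using z by (auto simp: rng_conv U_def L_def q_def)
    ultimately show "x \<in> verts G E" unfolding verts_def g(1) by blast
  next
    fix x assume "x \<in> verts G E"
    then obtain w where w: "rng (g w) \<subseteq> E" "x \<in> rng (g w)" unfolding verts_def g(1) by blast
    obtain i where i: "w \<in> L i" "x = q i w" using w(2) by (auto simp: rng_conv L_def q_def)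
    have "\<forall>j. \<exists>s. w \<in> L j \<longrightarrow> s \<in> S \<and> f s = q j w"
    proof
      fix j
      show "\<exists>s. w \<in> L j \<longrightarrow> s \<in> S \<and> f s = q j w"
      proof (cases "w \<in> L j")
        case True
        then have "q j w \<in> rng (g w)" by (auto simp: rng_conv L_def q_def)
        then have "q j w \<in> f ` S" using w(1) 1(3) by blast
        then show ?thesis by force
      qed simp
    qed
    then obtain s where s: "\<And>j. w \<in> L j \<Longrightarrow> s j \<in> S \<and> f (s j) = q j w" by metis
    define z where "z = merge (\<lambda>k. case k of 0 \<Rightarrow> w | Suc j \<Rightarrow> s j)"
    have "slice 0 z = w" "slice (Suc j) z = s j" for j by (simp_all add: z_def)
    then have "z \<in> U i" using i s by (auto simp: U_def K_def T_def)
    then show "x \<in> (\<Union>i. (\<lambda>z. q i (slice 0 z)) ` U i)"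
      using i \<open>slice 0 z = w\<close> by blast
  qed
  finally show ?thesis .
qed (simp add: verts_def)

section \<open>Generic points form a positive set\<close>

definition suslin_rep :: "'b::topological_space set \<Rightarrow> (nat \<Rightarrow> nat) set \<times> ((nat \<Rightarrow> nat) \<Rightarrow> 'b)" where
  "suslin_rep A = (SOME p. closed (fst p) \<and> continuous_on (fst p) (snd p) \<and> A = snd p ` fst p)"

text \<open>The Suslin scheme of \<open>A\<close> for a representation chosen once and for all, so
  that \<open>reqs\<close> can refer to the pieces of a set without further data.\<close>

definition piece :: "'b::topological_space set \<Rightarrow> nat list \<Rightarrow> 'b set" where
  "piece A u = snd (suslin_rep A) ` (fst (suslin_rep A) \<inter> cyl u)"

lemma suslin_rep:
  assumes "analytic A"
  shows "closed (fst (suslin_rep A))" "continuous_on (fst (suslin_rep A)) (snd (suslin_rep A))"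
    "A = snd (suslin_rep A) ` fst (suslin_rep A)"
proof -
  obtain S and f :: "(nat \<Rightarrow> nat) \<Rightarrow> _" where "closed S" "continuous_on S f" "A = f ` S"
    using assms by (rule analyticE)
  then have "\<exists>p::(nat \<Rightarrow> nat) set \<times> _. closed (fst p) \<and> continuous_on (fst p) (snd p) \<and> A = snd p ` fst p"
    by (intro exI[of _ "(S, f)"]) simp
  from someI_ex[OF this] show "closed (fst (suslin_rep A))"
    "continuous_on (fst (suslin_rep A)) (snd (suslin_rep A))"
    "A = snd (suslin_rep A) ` fst (suslin_rep A)"
    unfolding suslin_rep_def by blast+
qed

lemma piece_Nil: "analytic A \<Longrightarrow> piece A [] = A"
  using suslin_rep(3)[of A] by (simp add: piece_def)

lemma piece_split: "piece A u = (\<Union>n. piece A (u @ [n]))"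
proof -
  have "cyl u = (\<Union>n. cyl (u @ [n]))" by (auto simp: cyl_snoc)
  then show ?thesis unfolding piece_def by blast
qed

lemma piece_snoc_subset: "piece A (u @ [n]) \<subseteq> piece A u"
  by (auto simp: piece_def cyl_snoc)

lemma analytic_piece:
  assumes "analytic A"
  shows "analytic (piece A u)"
  unfolding piece_def
  by (rule analyticI[OF _ _ refl])
    (use suslin_rep[OF assms] closed_cyl in \<open>auto intro: continuous_on_subset\<close>)

text \<open>The branch lies in the closed domain of the representation, which meets all of its
  cylinders; its image is the limit, by continuity there.\<close>

lemma piece_limit:
  assumes A: "analytic A" and ne: "\<And>n. piece A (map z [0..<n]) \<noteq> {}"
  obtains x where "x \<in> A" "\<And>V. open V \<Longrightarrow> x \<in> V \<Longrightarrow> \<exists>n. piece A (map z [0..<n]) \<subseteq> V"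
proof -
  define S f where "S = fst (suslin_rep A)" and "f = snd (suslin_rep A)"
  note rep = suslin_rep[OF A, folded S_def f_def]
  have piece: "piece A u = f ` (S \<inter> cyl u)" for u by (simp add: piece_def S_def f_def)
  have "z \<in> S" using ne by (intro closed_limit_cyl[OF rep(1)]) (simp add: piece)
  show thesis
  proof (rule that)
    show "f z \<in> A" using rep(3) \<open>z \<in> S\<close> by blast
    fix V assume "open V" "f z \<in> V"
    then obtain U where U: "open U" "z \<in> U" "\<forall>y\<in>S. y \<in> U \<longrightarrow> f y \<in> V"
      using rep(2)[unfolded continuous_on_topological, rule_format, OF \<open>z \<in> S\<close>] by blast
    obtain n where "cyl (map z [0..<n]) \<subseteq> U" using cyl_basis[OF U(1,2)] .
    then have "piece A (map z [0..<n]) \<subseteq> V" unfolding piece using U(3) by blast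
    then show "\<exists>n. piece A (map z [0..<n]) \<subseteq> V" ..
  qed
qed

definition cbasis :: "'a::second_countable_topology set set" where
  "cbasis = (SOME B. countable B \<and> topological_basis B)"

lemma cbasis: "countable (cbasis::'a::second_countable_topology set set)"
  "topological_basis (cbasis::'a::second_countable_topology set set)"
  using someI_ex[OF ex_countable_basis[where 'a='a]] unfolding cbasis_def by auto

section \<open>Countable families closed under relations\<close>

definition closed_under :: "('x \<Rightarrow> 'x \<Rightarrow> 'x \<Rightarrow> bool) set \<Rightarrow> 'x set \<Rightarrow> bool" where
  "closed_under \<R> N \<longleftrightarrow> (\<forall>R\<in>\<R>. \<forall>x\<in>N. \<forall>y\<in>N. \<exists>z\<in>N. R x y z)"

text \<open>The downward Loewenheim-Skolem argument: close off the singleton under choice functions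
  for the relations in countably many rounds.\<close>

lemma countable_closed_under:
  assumes "countable \<R>" "closed_under \<R> Q" "a \<in> Q"
  obtains N where "countable N" "N \<subseteq> Q" "a \<in> N" "closed_under \<R> N"
proof -
  have "\<forall>R x y. \<exists>z. R \<in> \<R> \<and> x \<in> Q \<and> y \<in> Q \<longrightarrow> z \<in> Q \<and> R x y z"
    using assms(2) unfolding closed_under_def by blast
  then obtain w where w: "\<And>R x y. R \<in> \<R> \<Longrightarrow> x \<in> Q \<Longrightarrow> y \<in> Q \<Longrightarrow> w R x y \<in> Q \<and> R x y (w R x y)"
    by metis
  define g where "g = rec_nat {a} (\<lambda>_ N. N \<union> (\<lambda>(R, x, y). w R x y) ` (\<R> \<times> N \<times> N))"
  have g0: "g 0 = {a}" and gS: "g (Suc n) = g n \<union> (\<lambda>(R, x, y). w R x y) ` (\<R> \<times> g n \<times> g n)" for n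
    by (simp_all add: g_def)
  have mono: "m \<le> n \<Longrightarrow> g m \<subseteq> g n" for m n
    by (rule lift_Suc_mono_le[of g]) (auto simp: gS)
  have sub: "g n \<subseteq> Q" for n
  proof (induction n)
    case (Suc n)
    then show ?case using w by (fastforce simp: gS)
  qed (simp add: g0 assms(3))
  have cnt: "countable (g n)" for n
    by (induction n) (use assms(1) in \<open>auto simp: g0 gS\<close>)
  show thesis
  proof (rule that[of "\<Union>n. g n"])
    show "closed_under \<R> (\<Union>n. g n)" unfolding closed_under_def
    proof (intro ballI)
      fix R x y assume R: "R \<in> \<R>" and "x \<in> (\<Union>n. g n)" "y \<in> (\<Union>n. g n)"
      then obtain m n where "x \<in> g m" "y \<in> g n" by auto
      then have xy: "x \<in> g (max m n)" "y \<in> g (max m n)"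
        using mono[of m "max m n"] mono[of n "max m n"] by auto
      then have "w R x y \<in> g (Suc (max m n))" using R by (force simp: gS)
      moreover have "R x y (w R x y)" using w R xy sub by blast
      ultimately show "\<exists>z\<in>(\<Union>n. g n). R x y z" by blast
    qed
  qed (use sub cnt g0 in auto)
qed

section \<open>The ideal, the action and positive analytic sets\<close>

locale actionable =
  fixes I :: "'a::polish_space set set" and \<G> :: "'a edge set set"
    and \<Gamma> :: "nat monoid" and \<phi> :: "nat \<Rightarrow> 'a \<Rightarrow> 'a"
  assumes sigma: "sigma_ideal I"
    and countable_graphs: "countable \<G>"
    and analytic_graphs: "G \<in> \<G> \<Longrightarrow> analytic_in seq_space G"
    and action: "borel_action \<Gamma> \<phi>"
    and edges_in_orbits: "G \<in> \<G> \<Longrightarrow> e \<in> G \<Longrightarrow> \<exists>Q\<in>orbits \<Gamma> UNIV \<phi>. rng e \<subseteq> Q"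
    and graphs_invariant: "G \<in> \<G> \<Longrightarrow> g \<in> carrier \<Gamma> \<Longrightarrow> map_edge (\<phi> g) ` G \<in> \<G>"
    and ideal_iff: "A \<in> I \<longleftrightarrow>
      (\<exists>\<C>. countable \<C> \<and> \<C> \<subseteq> {B \<in> sets borel. \<exists>G\<in>\<G>. anticlique G B} \<and> A \<subseteq> \<Union>\<C>)"
begin

sublocale group_action \<Gamma> UNIV \<phi>
  using action by (simp add: borel_action_def)

lemma borel_act: "g \<in> carrier \<Gamma> \<Longrightarrow> \<phi> g \<in> borel \<rightarrow>\<^sub>M borel"
  using action by (simp add: borel_action_def)

lemma group_Gamma: "group \<Gamma>"
  using group_hom unfolding group_hom_def by blast

lemma inv_in: "g \<in> carrier \<Gamma> \<Longrightarrow> inv\<^bsub>\<Gamma>\<^esub> g \<in> carrier \<Gamma>"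
  using group.inv_closed[OF group_Gamma] .

lemma act_inv: "g \<in> carrier \<Gamma> \<Longrightarrow> \<phi> (inv\<^bsub>\<Gamma>\<^esub> g) (\<phi> g x) = x"
  using orbit_sym_aux[of g x "\<phi> g x"] by simp

lemma inv_act: "g \<in> carrier \<Gamma> \<Longrightarrow> \<phi> g (\<phi> (inv\<^bsub>\<Gamma>\<^esub> g) x) = x"
  using act_inv[OF inv_in, of g x] group.inv_inv[OF group_Gamma] by simp

lemma act_image_conv_vimage: "g \<in> carrier \<Gamma> \<Longrightarrow> \<phi> g ` A = \<phi> (inv\<^bsub>\<Gamma>\<^esub> g) -` A"
  by (auto simp: act_inv inv_act image_iff) (metis inv_act)

lemma borel_act_image: "g \<in> carrier \<Gamma> \<Longrightarrow> A \<in> sets borel \<Longrightarrow> \<phi> g ` A \<in> sets borel"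
  using measurable_sets[OF borel_act[OF inv_in], of g A] by (simp add: act_image_conv_vimage)

lemma same_orbit:
  assumes "x \<in> rng e" "y \<in> rng e" "e \<in> G" "G \<in> \<G>"
  obtains g where "g \<in> carrier \<Gamma>" "y = \<phi> g x"
proof -
  obtain Q where Q: "Q \<in> orbits \<Gamma> UNIV \<phi>" "rng e \<subseteq> Q" using edges_in_orbits assms by blast
  then obtain x0 where "Q = orbit \<Gamma> \<phi> x0" unfolding orbits_def by blast
  then have "x \<in> orbit \<Gamma> \<phi> x0" "y \<in> orbit \<Gamma> \<phi> x0" using assms Q by auto
  then have "y \<in> orbit \<Gamma> \<phi> x"
    using orbit_sym[of x0 x] orbit_trans[of x x0 y] by simp
  then show thesis using that unfolding orbit_def by blast
qed

lemma ideal_mono: "A \<in> I \<Longrightarrow> B \<subseteq> A \<Longrightarrow> B \<in> I"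
  using sigma unfolding sigma_ideal_def by blast

lemma ideal_Union: "countable \<C> \<Longrightarrow> \<C> \<subseteq> I \<Longrightarrow> \<Union>\<C> \<in> I"
  using sigma unfolding sigma_ideal_def by blast

lemma empty_in_ideal: "{} \<in> I"
  using sigma unfolding sigma_ideal_def by blast

lemma ideal_UN: "countable J \<Longrightarrow> (\<And>i. i \<in> J \<Longrightarrow> A i \<in> I) \<Longrightarrow> (\<Union>i\<in>J. A i) \<in> I"
  by (rule ideal_Union) auto

lemma ideal_Un: "A \<in> I \<Longrightarrow> B \<in> I \<Longrightarrow> A \<union> B \<in> I"
  using ideal_Union[of "{A, B}"] by simp

lemma anticlique_in_ideal: "B \<in> sets borel \<Longrightarrow> G \<in> \<G> \<Longrightarrow> anticlique G B \<Longrightarrow> B \<in> I"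
  unfolding ideal_iff by (intro exI[of _ "{B}"]) auto

text \<open>The ideal has non-Borel members as well. Removing a Borel hull instead of the set itself
  does not leave the class of analytic sets.\<close>

lemma borel_hull_in_ideal:
  assumes "A \<in> I"
  obtains K where "K \<in> sets borel" "K \<in> I" "A \<subseteq> K"
proof -
  obtain \<C> where C: "countable \<C>" "\<C> \<subseteq> {B \<in> sets borel. \<exists>G\<in>\<G>. anticlique G B}" "A \<subseteq> \<Union>\<C>"
    using assms unfolding ideal_iff[of A] by blast
  show thesis
  proof (rule that[of "\<Union>\<C>"])
    show "\<Union>\<C> \<in> sets borel" using C by (intro sets.countable_Union) auto
    show "\<Union>\<C> \<in> I" unfolding ideal_iff using C by blast
  qed (rule C)
qed

lemma anticlique_act:
  assumes "G \<in> \<G>" "g \<in> carrier \<Gamma>" "anticlique G B"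
  shows "anticlique (map_edge (\<phi> g) ` G) (\<phi> g ` B)"
  unfolding anticlique_def
proof (intro equals0I)
  fix e' assume "e' \<in> seqs (\<phi> g ` B) \<inter> map_edge (\<phi> g) ` G"
  then obtain e where e: "e \<in> G" "e' = map_edge (\<phi> g) e" "rng e' \<subseteq> \<phi> g ` B"
    using seqs_iff_rng[of e' "\<phi> g ` B"] by blast
  have "G \<subseteq> seqs UNIV" by (intro analytic_in_subset_seqs analytic_graphs assms(1))
  moreover have "rng e \<subseteq> B"
  proof
    fix x assume "x \<in> rng e"
    then have "\<phi> g x \<in> rng e'" using e(2) by (auto simp: rng_def map_edge_def)
    then obtain y where "y \<in> B" "\<phi> g x = \<phi> g y" using e(3) by blast
    then show "x \<in> B" using act_inv[OF assms(2)] by metis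
  qed
  ultimately have "e \<in> seqs B" using seqs_iff_rng[of e B] e(1) by blast
  then show False using assms(3) e(1) unfolding anticlique_def by blast
qed

lemma ideal_act:
  assumes "A \<in> I" "g \<in> carrier \<Gamma>"
  shows "\<phi> g ` A \<in> I"
proof -
  obtain \<C> where C: "countable \<C>" "\<C> \<subseteq> {B \<in> sets borel. \<exists>G\<in>\<G>. anticlique G B}" "A \<subseteq> \<Union>\<C>"
    using assms unfolding ideal_iff[of A] by blast
  have "(`) (\<phi> g) ` \<C> \<subseteq> {B \<in> sets borel. \<exists>G\<in>\<G>. anticlique G B}"
    using C(2) borel_act_image[OF assms(2)] anticlique_act[OF _ assms(2)] graphs_invariant[OF _ assms(2)]
    by blast
  moreover have "\<phi> g ` A \<subseteq> \<Union>((`) (\<phi> g) ` \<C>)" using C(3) by blast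
  ultimately show ?thesis unfolding ideal_iff using C(1) by blast
qed

lemma ideal_act_iff: "g \<in> carrier \<Gamma> \<Longrightarrow> \<phi> g ` A \<in> I \<longleftrightarrow> A \<in> I"
proof
  assume g: "g \<in> carrier \<Gamma>"
  assume "\<phi> g ` A \<in> I"
  then have "\<phi> (inv\<^bsub>\<Gamma>\<^esub> g) ` (\<phi> g ` A) \<in> I"
    by (rule ideal_act[OF _ inv_in[OF g]])
  then show "A \<in> I" using act_inv[OF g] by (simp add: image_image)
qed (rule ideal_act)

definition pos :: "'a set set" where
  "pos = {A. analytic A \<and> A \<notin> I}"

lemma pos_minus:
  assumes "H \<in> pos" "K \<in> sets borel" "K \<in> I"
  shows "H - K \<in> pos"
proof -
  have "analytic (H \<inter> - K)"
    using assms analytic_Int[OF _ analytic_borel, of H "- K"] by (simp add: pos_def)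
  moreover have "H - K \<notin> I"
    using ideal_mono[OF ideal_Un[OF _ assms(3)], of "H - K" H] assms(1) by (auto simp: pos_def)
  ultimately show ?thesis by (simp add: pos_def Diff_eq)
qed

text \<open>Removing the vertices of the \<open>G\<close>-edges inside \<open>E\<close> leaves an analytic anticlique, which is
  small because it has a Borel anticlique hull.\<close>

lemma verts_pos:
  assumes E: "E \<in> pos" and G: "G \<in> \<G>" "\<forall>e\<in>G. rng e \<noteq> {}"
  shows "verts G E \<in> pos"
proof -
  have "verts G E \<notin> I"
  proof
    assume "verts G E \<in> I"
    then obtain K where K: "K \<in> sets borel" "K \<in> I" "verts G E \<subseteq> K" by (rule borel_hull_in_ideal)
    have EK: "E - K \<in> pos" using E K by (intro pos_minus)
    have "anticlique G (E - K)" unfolding anticlique_def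
    proof (intro equals0I)
      fix e assume "e \<in> seqs (E - K) \<inter> G"
      then have e: "e \<in> G" "rng e \<subseteq> E - K" using seqs_iff_rng[of e "E - K"] by auto
      then obtain x where "x \<in> rng e" using G(2) by blast
      then have "x \<in> verts G E" using e unfolding verts_def by blast
      then show False using K(3) e \<open>x \<in> rng e\<close> by blast
    qed
    then obtain B where "B \<in> sets borel" "E - K \<subseteq> B" "anticlique G B"
      using analytic_anticlique_hull[OF analytic_graphs[OF G(1)]] EK by (auto simp: pos_def)
    then have "E - K \<in> I" using anticlique_in_ideal[OF _ G(1)] ideal_mono by blast
    then show False using EK by (simp add: pos_def)
  qed
  then show ?thesis using analytic_verts[OF analytic_graphs[OF G(1)]] E by (simp add: pos_def)
qed

text \<open>The closure properties asked of a countable family, as relations between two given members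
  and one to be found. They decide basic open sets (for the Baire property of Borel sets), make
  the action one by homeomorphisms, provide edges, and decide the Suslin pieces of a member (so
  that generic filters converge).\<close>

definition reqs :: "('a set \<Rightarrow> 'a set \<Rightarrow> 'a set \<Rightarrow> bool) set" where
  "reqs = 
     (\<lambda>V E H H'. H' \<subseteq> H \<and> (H' \<subseteq> V \<or> H' \<inter> V = {})) ` cbasis \<union>
     (\<lambda>g E H H'. H' = \<phi> g ` H) ` carrier \<Gamma> \<union>
     (\<lambda>G E H H'. H' \<subseteq> verts G H) ` {G\<in>\<G>. \<forall>e\<in>G. rng e \<noteq> {}} \<union>
     (\<lambda>u E H H'. H' \<subseteq> H \<and> (H' \<inter> piece E u = {} \<or> (\<exists>n. H' \<subseteq> piece E (u @ [n])))) ` UNIV"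

lemma countable_reqs: "countable reqs"
  unfolding reqs_def using cbasis(1) countable_graphs by (auto intro: countable_subset)

lemma closed_under_pos: "closed_under reqs pos"
proof -
  have 1: "\<exists>H'\<in>pos. H' \<subseteq> H \<and> (H' \<subseteq> V \<or> H' \<inter> V = {})" if "H \<in> pos" "V \<in> cbasis" for H V
  proof -
    have "open V" using that(2) cbasis(2) topological_basis_open by blast
    then have an: "analytic (H \<inter> V)" "analytic (H \<inter> - V)"
      using that(1) analytic_Int[OF _ analytic_borel, of H V] analytic_Int[OF _ analytic_borel, of H "- V"]
      by (simp_all add: pos_def)
    have "H \<inter> V \<notin> I \<or> H \<inter> - V \<notin> I"
    proof (rule ccontr)
      assume "\<not> ?thesis"
      then have "(H \<inter> V) \<union> (H \<inter> - V) \<in> I" by (intro ideal_Un) auto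
      moreover have "(H \<inter> V) \<union> (H \<inter> - V) = H" by blast
      ultimately show False using that(1) by (simp add: pos_def)
    qed
    then have "H \<inter> V \<in> pos \<or> H \<inter> - V \<in> pos" using an by (simp add: pos_def)
    then show ?thesis by blast
  qed
  have 2: "\<phi> g ` H \<in> pos" if "H \<in> pos" "g \<in> carrier \<Gamma>" for H g
    using that by (auto simp: pos_def ideal_act_iff intro: analytic_borel_image borel_act)
  have 3: "\<exists>H'\<in>pos. H' \<subseteq> H \<and> (H' \<inter> piece E u = {} \<or> (\<exists>n. H' \<subseteq> piece E (u @ [n])))"
    if "E \<in> pos" "H \<in> pos" for E H u
  \<comment> \<open>A small intersection is removed together with a Borel hull; for a large one, one
    of the countably many subpieces must cut out a positive set.\<close>
  proof (cases "H \<inter> piece E u \<in> I")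
    case True
    then obtain K where "K \<in> sets borel" "K \<in> I" "H \<inter> piece E u \<subseteq> K" by (rule borel_hull_in_ideal)
    then show ?thesis using pos_minus[OF that(2)] by (intro bexI[of _ "H - K"]) auto
  next
    case False
    have "\<exists>n. H \<inter> piece E (u @ [n]) \<notin> I"
    proof (rule ccontr)
      assume "\<not> ?thesis"
      then have "(\<Union>n. H \<inter> piece E (u @ [n])) \<in> I" by (intro ideal_UN) auto
      moreover have "(\<Union>n. H \<inter> piece E (u @ [n])) = H \<inter> piece E u"
        unfolding piece_split[of E u] by blast
      ultimately show False using False by simp
    qed
    then obtain n where n: "H \<inter> piece E (u @ [n]) \<notin> I" by blast
    have "analytic (H \<inter> piece E (u @ [n]))"
      using that by (intro analytic_Int analytic_piece) (auto simp: pos_def)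
    then show ?thesis using n by (intro bexI[of _ "H \<inter> piece E (u @ [n])"]) (auto simp: pos_def)
  qed
  show ?thesis
    unfolding closed_under_def reqs_def using 1 2 3 verts_pos by (auto; blast)
qed

end

section \<open>Baire category for a countable family of positive sets\<close>

locale forcing_family = actionable +
  fixes N :: "'a set set"
  assumes countable_N: "countable N" and N_pos: "N \<subseteq> pos" and N_closed: "closed_under reqs N"
begin

lemma N_analytic: "E \<in> N \<Longrightarrow> analytic E"
  using N_pos by (auto simp: pos_def)

lemma N_nonempty: "E \<in> N \<Longrightarrow> E \<noteq> {}"
  using N_pos empty_in_ideal by (auto simp: pos_def)

text \<open>Density is with respect to inclusion on \<open>N\<close>; on the side of points,
  \<open>\<Union>D\<close> is the corresponding dense open set.\<close>

definition dense :: "'a set set \<Rightarrow> bool" where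
  "dense D \<longleftrightarrow> D \<subseteq> N \<and> (\<forall>H\<in>N. \<exists>F\<in>D. F \<subseteq> H)"

definition basis_dense :: "'a set \<Rightarrow> 'a set set" where
  "basis_dense V = {F\<in>N. F \<subseteq> V \<or> F \<inter> V = {}}"

definition piece_dense :: "'a set \<Rightarrow> nat list \<Rightarrow> 'a set set" where
  "piece_dense E u = {F\<in>N. F \<inter> piece E u = {} \<or> (\<exists>n. F \<subseteq> piece E (u @ [n]))}"

lemma reqsD: "R \<in> reqs \<Longrightarrow> E \<in> N \<Longrightarrow> H \<in> N \<Longrightarrow> \<exists>H'\<in>N. R E H H'"
  using N_closed unfolding closed_under_def by blast

lemma dense_basis_dense:
  assumes "V \<in> cbasis"
  shows "dense (basis_dense V)"
proof -
  have *: "(\<lambda>E H H'. H' \<subseteq> H \<and> (H' \<subseteq> V \<or> H' \<inter> V = {})) \<in> reqs"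
    unfolding reqs_def using assms by blast
  show ?thesis unfolding dense_def basis_dense_def using reqsD[OF *] by blast
qed

lemma act_N:
  assumes "g \<in> carrier \<Gamma>" "H \<in> N"
  shows "\<phi> g ` H \<in> N"
proof -
  have "(\<lambda>E H H'. H' = \<phi> g ` H) \<in> reqs" using assms(1) unfolding reqs_def by blast
  from reqsD[OF this assms(2) assms(2)] show ?thesis by simp
qed

lemma verts_N:
  assumes "G \<in> \<G>" "\<forall>e\<in>G. rng e \<noteq> {}" "H \<in> N"
  shows "\<exists>H'\<in>N. H' \<subseteq> verts G H"
proof -
  have "(\<lambda>E H H'. H' \<subseteq> verts G H) \<in> reqs" using assms(1,2) unfolding reqs_def by blast
  from reqsD[OF this assms(3) assms(3)] show ?thesis .
qed

lemma dense_piece_dense: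
  assumes "E \<in> N"
  shows "dense (piece_dense E u)"
proof -
  have *: "(\<lambda>E H H'. H' \<subseteq> H \<and> (H' \<inter> piece E u = {} \<or> (\<exists>n. H' \<subseteq> piece E (u @ [n])))) \<in> reqs"
    unfolding reqs_def by blast
  show ?thesis unfolding dense_def piece_dense_def using reqsD[OF * assms] by blast
qed

text \<open>The piece requirement for the empty sequence: \<open>piece E []\<close> is
  \<open>E\<close> itself.\<close>

lemma dense_decide: "E \<in> N \<Longrightarrow> H \<in> N \<Longrightarrow> \<exists>F\<in>N. F \<subseteq> H \<and> (F \<subseteq> E \<or> F \<inter> E = {})"
proof -
  assume E: "E \<in> N" and H: "H \<in> N"
  obtain F where F: "F \<in> piece_dense E []" "F \<subseteq> H"
    using dense_piece_dense[OF E] H unfolding dense_def by blast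
  have "piece E [] = E" using E by (intro piece_Nil N_analytic)
  then have "F \<inter> E = {} \<or> F \<subseteq> E"
    using F(1) piece_snoc_subset[of E "[]"] unfolding piece_dense_def by auto
  then show ?thesis using F unfolding piece_dense_def by blast
qed

text \<open>A decreasing sequence in \<open>N\<close> is built that meets the given dense sets and
  also decides all pieces of all members of \<open>N\<close>. For each member containing a term of
  the sequence, the decisions trace a branch of its Suslin scheme, so the sequence converges to a
  point of that very member. These limits coincide, hence the point lies in every term.\<close>

lemma baire:
  assumes D: "countable \<D>" "\<And>D. D \<in> \<D> \<Longrightarrow> dense D" and E: "E \<in> N"
  shows "\<exists>x\<in>E. \<forall>D\<in>\<D>. x \<in> \<Union>D"
proof -
  define \<E> where "\<E> = \<D> \<union> (\<lambda>(F, u). piece_dense F u) ` (N \<times> UNIV)"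
  have cE: "countable \<E>" unfolding \<E>_def using D(1) countable_N by simp
  have dE: "dense D" if "D \<in> \<E>" for D
    using that D(2) dense_piece_dense unfolding \<E>_def by auto
  have "\<E> \<noteq> {}" unfolding \<E>_def using E by auto
  define en where "en = from_nat_into \<E>"
  have en: "range en = \<E>" unfolding en_def using cE \<open>\<E> \<noteq> {}\<close> by simp
  have step: "\<exists>H'. H' \<in> N \<and> H' \<in> en n \<and> H' \<subseteq> H" if "H \<in> N" for H n
  proof -
    have "dense (en n)" using dE en by blast
    then show ?thesis using that unfolding dense_def by blast
  qed
  have "\<exists>s. \<forall>n. (s n \<in> N \<and> (n = 0 \<longrightarrow> s n = E)) \<and> (s (Suc n) \<in> en n \<and> s (Suc n) \<subseteq> s n)"
    using step E by (intro dependent_nat_choice) auto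
  then obtain s where s: "\<And>n. s n \<in> N" "s 0 = E" "\<And>n. s (Suc n) \<in> en n" "\<And>n. s (Suc n) \<subseteq> s n"
    by blast
  have anti: "s n \<subseteq> s m" if "m \<le> n" for m n
    using that s(4) by (rule lift_Suc_antimono_le[of s, rotated])
  have lim: "\<exists>x\<in>F. \<forall>V. open V \<and> x \<in> V \<longrightarrow> (\<exists>k. s k \<subseteq> V)" if F: "F \<in> N" "s j \<subseteq> F" for F j
  proof -
    obtain z where z: "\<And>n. \<exists>k. s k \<subseteq> piece F (map z [0..<n])"
    proof (rule branch_exists[of "\<lambda>u. \<exists>k. s k \<subseteq> piece F u"])
      show "\<exists>k. s k \<subseteq> piece F []" using F piece_Nil[OF N_analytic[OF F(1)]] by auto
      fix u assume "\<exists>k. s k \<subseteq> piece F u"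
      then obtain k where k: "s k \<subseteq> piece F u" ..
      have "piece_dense F u \<in> \<E>" unfolding \<E>_def using F(1) by auto
      then obtain i where "en i = piece_dense F u" using en by (metis imageE)
      then have i: "s (Suc i) \<inter> piece F u = {} \<or> (\<exists>n. s (Suc i) \<subseteq> piece F (u @ [n]))"
        using s(3)[of i] unfolding piece_dense_def by auto
      define m where "m = max k (Suc i)"
      have m: "s m \<subseteq> s k" "s m \<subseteq> s (Suc i)" unfolding m_def by (simp_all add: anti)
      have "s m \<noteq> {}" using N_nonempty s(1) by blast
      then obtain n where "s (Suc i) \<subseteq> piece F (u @ [n])" using i m k by blast
      then show "\<exists>n k. s k \<subseteq> piece F (u @ [n])" by blast
    qed blast
    have ne: "piece F (map z [0..<n]) \<noteq> {}" for n
      using z[of n] N_nonempty[OF s(1)] by blast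
    obtain x where x: "x \<in> F" "\<And>V. open V \<Longrightarrow> x \<in> V \<Longrightarrow> \<exists>n. piece F (map z [0..<n]) \<subseteq> V"
      using piece_limit[OF N_analytic[OF F(1)] ne] by blast
    show ?thesis
    proof (intro bexI[OF _ x(1)] allI impI)
      fix V assume "open V \<and> x \<in> V"
      then obtain n where "piece F (map z [0..<n]) \<subseteq> V" using x(2) by blast
      then show "\<exists>k. s k \<subseteq> V" using z[of n] by blast
    qed
  qed
  obtain x where x: "x \<in> E" "\<And>V. open V \<Longrightarrow> x \<in> V \<Longrightarrow> \<exists>k. s k \<subseteq> V"
    using lim[OF E, of 0] s(2) by blast
  have "x \<in> s j" for j
  proof -
    obtain y where y: "y \<in> s j" "\<And>V. open V \<Longrightarrow> y \<in> V \<Longrightarrow> \<exists>k. s k \<subseteq> V"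
      using lim[of "s j" j, OF s(1) order_refl] by blast
    \<comment> \<open>Both points are limits of the same decreasing sequence of nonempty sets, and
      the space is Hausdorff.\<close>
    have "x = y"
    proof (rule ccontr)
      assume "x \<noteq> y"
      from hausdorff[OF this] obtain U V where UV: "open U" "open V" "x \<in> U" "y \<in> V" "U \<inter> V = {}"
        by blast
      obtain k l where "s k \<subseteq> U" "s l \<subseteq> V" using x(2) y(2) UV by meson
      moreover have "s (max k l) \<subseteq> s k" "s (max k l) \<subseteq> s l" by (simp_all add: anti)
      ultimately show False using UV(5) N_nonempty[OF s(1), of "max k l"] by blast
    qed
    then show ?thesis using y(1) by simp
  qed
  note xs = this
  have "x \<in> \<Union>D" if "D \<in> \<D>" for D
  proof -
    have "D \<in> range en" using that unfolding en \<E>_def by blast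
    then obtain i where "D = en i" by blast
    then show ?thesis using s(3)[of i] xs[of "Suc i"] by blast
  qed
  then show ?thesis using x(1) by blast
qed

text \<open>Meagerness in the topology on the generic points that is generated by \<open>N\<close>.\<close>

definition meager_in :: "'a set \<Rightarrow> 'a set \<Rightarrow> bool" where
  "meager_in Z E \<longleftrightarrow> (\<exists>\<D>. countable \<D> \<and> (\<forall>D\<in>\<D>. dense D) \<and> (\<forall>x\<in>Z \<inter> E. \<exists>D\<in>\<D>. x \<notin> \<Union>D))"

lemma meager_in_mono: "meager_in Z E \<Longrightarrow> Z' \<inter> E' \<subseteq> Z \<inter> E \<Longrightarrow> meager_in Z' E'"
  unfolding meager_in_def by (elim exE, rule exI) blast

lemma meager_in_disjoint: "Z \<inter> E = {} \<Longrightarrow> meager_in Z E"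
  unfolding meager_in_def by (intro exI[of _ "{}"]) auto

lemma meager_in_UN:
  assumes "countable J" "\<And>i. i \<in> J \<Longrightarrow> meager_in (Z i) E"
  shows "meager_in (\<Union>i\<in>J. Z i) E"
proof -
  have "\<forall>i\<in>J. \<exists>\<D>. countable \<D> \<and> (\<forall>D\<in>\<D>. dense D) \<and> (\<forall>x\<in>Z i \<inter> E. \<exists>D\<in>\<D>. x \<notin> \<Union>D)"
    using assms(2) unfolding meager_in_def by blast
  from bchoice[OF this] obtain \<D> where
    "\<forall>i\<in>J. countable (\<D> i) \<and> (\<forall>D\<in>\<D> i. dense D) \<and> (\<forall>x\<in>Z i \<inter> E. \<exists>D\<in>\<D> i. x \<notin> \<Union>D)" ..
  note \<D> = this
  show ?thesis unfolding meager_in_def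
  proof (intro exI[of _ "\<Union>i\<in>J. \<D> i"] conjI ballI)
    show "countable (\<Union>i\<in>J. \<D> i)" using assms(1) \<D> by blast
    show "dense D" if "D \<in> (\<Union>i\<in>J. \<D> i)" for D using that \<D> by blast
    fix x assume "x \<in> (\<Union>i\<in>J. Z i) \<inter> E"
    then obtain i where "i \<in> J" "x \<in> Z i \<inter> E" by blast
    then obtain D where "D \<in> \<D> i" "x \<notin> \<Union>D" using \<D> by blast
    then show "\<exists>D\<in>(\<Union>i\<in>J. \<D> i). x \<notin> \<Union>D" using \<open>i \<in> J\<close> by blast
  qed
qed

lemma not_meager_in:
  assumes "E \<in> N" "meager_in Z E" "E \<subseteq> Z"
  shows False
proof -
  obtain \<D> where D: "countable \<D>" "\<And>D. D \<in> \<D> \<Longrightarrow> dense D" "\<And>x. x \<in> Z \<inter> E \<Longrightarrow> \<exists>D\<in>\<D>. x \<notin> \<Union>D"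
    using assms(2) unfolding meager_in_def by auto
  obtain x where "x \<in> E" "\<forall>D\<in>\<D>. x \<in> \<Union>D" using baire[OF D(1,2) assms(1)] by blast
  then show False using D(3)[of x] assms(3) by blast
qed

text \<open>A form of the Banach category theorem. Since \<open>N\<close> is countable, the
  witnesses for all members in which \<open>Z\<close> is meager can simply be united; the dense set
  \<open>W\<close> excludes the points outside all of these members.\<close>

lemma meager_in_local:
  assumes E: "E \<in> N" and loc: "\<And>H. H \<in> N \<Longrightarrow> H \<subseteq> E \<Longrightarrow> \<exists>F\<in>N. F \<subseteq> H \<and> meager_in Z F"
  shows "meager_in Z E"
proof -
  define M where "M = {F\<in>N. meager_in Z F}"
  have "\<forall>F\<in>M. \<exists>\<D>. countable \<D> \<and> (\<forall>D\<in>\<D>. dense D) \<and> (\<forall>x\<in>Z \<inter> F. \<exists>D\<in>\<D>. x \<notin> \<Union>D)"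
    unfolding M_def meager_in_def by blast
  from bchoice[OF this] obtain \<D> where
    \<D>: "\<forall>F\<in>M. countable (\<D> F) \<and> (\<forall>D\<in>\<D> F. dense D) \<and> (\<forall>x\<in>Z \<inter> F. \<exists>D\<in>\<D> F. x \<notin> \<Union>D)" ..
  \<comment> \<open>The members disjoint from \<open>E\<close> only make \<open>W\<close> dense; a
    point of \<open>E\<close> in \<open>\<Union>W\<close> has to lie in a member from
    \<open>M\<close>.\<close>
  define W where "W = M \<union> {F\<in>N. F \<inter> E = {}}"
  have "dense W" unfolding dense_def
  proof (intro conjI ballI)
    show "W \<subseteq> N" unfolding W_def M_def by blast
    fix H assume "H \<in> N"
    then obtain F where F: "F \<in> N" "F \<subseteq> H" "F \<subseteq> E \<or> F \<inter> E = {}" using dense_decide[OF E] by blast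
    show "\<exists>F\<in>W. F \<subseteq> H"
    proof (cases "F \<subseteq> E")
      case True
      then obtain F' where "F' \<in> N" "F' \<subseteq> F" "meager_in Z F'" using loc F by blast
      then show ?thesis using F(2) unfolding W_def M_def by blast
    next
      case False
      then show ?thesis using F unfolding W_def by blast
    qed
  qed
  moreover have "countable (insert W (\<Union>F\<in>M. \<D> F))"
    using \<D> countable_N unfolding M_def by (auto intro: countable_subset)
  moreover have "\<exists>D\<in>insert W (\<Union>F\<in>M. \<D> F). x \<notin> \<Union>D" if x: "x \<in> Z \<inter> E" for x
  proof (cases "x \<in> \<Union>W")
    case True
    then obtain F where "F \<in> M" "x \<in> F" using x unfolding W_def by blast
    moreover from this(1) have "\<forall>x\<in>Z \<inter> F. \<exists>D\<in>\<D> F. x \<notin> \<Union>D" using \<D> by simp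
    ultimately obtain D where "D \<in> \<D> F" "x \<notin> \<Union>D" using x by (metis IntD1 IntI)
    then show ?thesis using \<open>F \<in> M\<close> by blast
  qed blast
  moreover have "dense D" if "D \<in> (\<Union>F\<in>M. \<D> F)" for D using that \<D> by auto
  ultimately show ?thesis unfolding meager_in_def
    by (intro exI[of _ "insert W (\<Union>F\<in>M. \<D> F)"]) simp
qed

text \<open>Induction on Borel sets with \<open>E\<close> arbitrary. For open sets and unions: if no
  member below \<open>E\<close> makes the set comeager, then each of countably many parts is locally
  meager, hence meager in \<open>E\<close>, and so is their union. Complements are covered by the
  symmetry of the claim.\<close>

lemma baire_property:
  assumes "B \<in> sets borel" "E \<in> N"
  shows "\<exists>F\<in>N. F \<subseteq> E \<and> (meager_in B F \<or> meager_in (- B) F)"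
proof -
  have "B \<in> sigma_sets UNIV {S. open S}" using assms by (simp add: borel_def)
  then show ?thesis using assms(2)
  proof (induction arbitrary: E)
    case (Basic V)
    obtain \<V> where V: "\<V> \<subseteq> cbasis" "V = \<Union>\<V>" using Basic cbasis(2) unfolding topological_basis_def by auto
    show ?case
    proof (cases "\<exists>F\<in>N. F \<subseteq> E \<and> F \<subseteq> V")
      case True
      then obtain F where "F \<in> N" "F \<subseteq> E" "F \<subseteq> V" by blast
      moreover from this have "meager_in (- V) F" by (intro meager_in_disjoint) blast
      ultimately show ?thesis by blast
    next
      case False
      have "meager_in U E" if U: "U \<in> \<V>" for U
      proof (rule meager_in_local[OF Basic(2)])
        fix H assume H: "H \<in> N" "H \<subseteq> E"
        have "dense (basis_dense U)" using U V by (intro dense_basis_dense) blast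
        then obtain F where F: "F \<in> N" "F \<subseteq> H" "F \<subseteq> U \<or> F \<inter> U = {}"
          using H(1) unfolding dense_def basis_dense_def by blast
        then have "U \<inter> F = {}" using False U V H by blast
        then show "\<exists>F\<in>N. F \<subseteq> H \<and> meager_in U F" using F meager_in_disjoint by blast
      qed
      moreover have "countable \<V>" using V(1) cbasis(1) countable_subset by blast
      ultimately have "meager_in V E" using meager_in_UN[of \<V> "\<lambda>U. U" E] V(2) by simp
      then show ?thesis using Basic(2) by blast
    qed
  next
    case Empty
    then show ?case using meager_in_disjoint by blast
  next
    case (Compl a)
    then show ?case unfolding Compl_eq_Diff_UNIV[symmetric] double_complement by blast
  next
    case (Union a)
    show ?case
    proof (cases "\<exists>i. \<exists>F\<in>N. F \<subseteq> E \<and> meager_in (- a i) F")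
      case True
      then obtain i F where "F \<in> N" "F \<subseteq> E" "meager_in (- a i) F" by blast
      moreover from this(3) have "meager_in (- (\<Union>i. a i)) F" by (rule meager_in_mono) blast
      ultimately show ?thesis by blast
    next
      case False
      have "meager_in (a i) E" for i
      proof (rule meager_in_local[OF Union.prems])
        fix H assume "H \<in> N" "H \<subseteq> E"
        then show "\<exists>F\<in>N. F \<subseteq> H \<and> meager_in (a i) F" using Union.IH[of H i] False by blast
      qed
      then have "meager_in (\<Union>i. a i) E" by (intro meager_in_UN) auto
      then show ?thesis using Union.prems by blast
    qed
  qed
qed

theorem generic_points_positive:
  assumes D: "countable \<D>" "\<And>D. D \<in> \<D> \<Longrightarrow> dense D" and p: "p \<in> N"
  shows "{x\<in>p. \<forall>D\<in>\<D>. x \<in> \<Union>D} \<notin> I"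
proof
  define X where "X = {x\<in>p. \<forall>D\<in>\<D>. x \<in> \<Union>D}"
  assume "{x\<in>p. \<forall>D\<in>\<D>. x \<in> \<Union>D} \<in> I"
  then have "X \<in> I" by (simp only: X_def)
  then obtain \<C> where C: "countable \<C>" "\<C> \<subseteq> {B \<in> sets borel. \<exists>G\<in>\<G>. anticlique G B}"
    "X \<subseteq> \<Union>\<C>"
    unfolding ideal_iff[of X] by blast
  have "\<exists>B\<in>\<C>. \<not> meager_in B p"
  proof (rule ccontr)
    assume "\<not> ?thesis"
    then have "meager_in (\<Union>B\<in>\<C>. B) p" using C(1) by (intro meager_in_UN) auto
    moreover have "meager_in (- (\<Union>B\<in>\<C>. B)) p"
      unfolding meager_in_def using D C(3) unfolding X_def by (intro exI[of _ \<D>]) auto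
    \<comment> \<open>If all sets of the cover were meager in \<open>p\<close>, their union and its
      complement, which has no generic point of \<open>p\<close>, would together make the whole
      space meager in \<open>p\<close>.\<close>
    ultimately have "meager_in (\<Union>b::bool. if b then \<Union>B\<in>\<C>. B else - (\<Union>B\<in>\<C>. B)) p"
      by (intro meager_in_UN) auto
    then show False by (rule not_meager_in[OF p]) auto
  qed
  then obtain B where "B \<in> \<C>" and B_p: "\<not> meager_in B p" by blast
  moreover from this(1) C(2) have "B \<in> {B \<in> sets borel. \<exists>G\<in>\<G>. anticlique G B}" by (rule rev_subsetD)
  ultimately obtain G where B: "B \<in> sets borel" "G \<in> \<G>" "anticlique G B" by auto
  \<comment> \<open>The contrapositive of \<open>meager_in_local\<close>: below some
    \<open>H\<close>, no member makes \<open>B\<close> meager, so the Baire property must yield a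
    member in which \<open>B\<close> is comeager.\<close>
  obtain H where H: "H \<in> N" "\<And>F. F \<in> N \<Longrightarrow> F \<subseteq> H \<Longrightarrow> \<not> meager_in B F"
    using B_p meager_in_local[OF p] by metis
  obtain F where F: "F \<in> N" "meager_in (- B) F"
    using baire_property[OF B(1) H(1)] H(2) by blast
  then obtain \<E> where E: "countable \<E>" "\<And>D. D \<in> \<E> \<Longrightarrow> dense D" "\<And>x. x \<in> F \<Longrightarrow> x \<notin> B \<Longrightarrow> \<exists>D\<in>\<E>. x \<notin> \<Union>D"
    unfolding meager_in_def by auto
  \<comment> \<open>The empty sequence would be an edge inside every set, so a hypergraph with an
    anticlique does not contain it.\<close>
  have G: "\<forall>e\<in>G. rng e \<noteq> {}"
  proof (intro ballI notI)
    fix e assume "e \<in> G" "rng e = {}"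
    moreover have "G \<subseteq> seqs UNIV" by (intro analytic_in_subset_seqs analytic_graphs B(2))
    ultimately have "e \<in> seqs B" using seqs_iff_rng[of e B] by auto
    then show False using B(3) \<open>e \<in> G\<close> unfolding anticlique_def by blast
  qed
  obtain F' where F': "F' \<in> N" "F' \<subseteq> verts G F" using verts_N[OF B(2) G F(1)] by blast
  \<comment> \<open>Countably many translates of the dense sets, again dense because the action
    permutes \<open>N\<close>. If \<open>x = \<phi> g y\<close>, then lying in the
    \<open>g\<close>-translates for \<open>x\<close> amounts to lying in the original sets for
    \<open>y\<close>; so one vertex suffices to control the whole edge.\<close>
  define \<E>' where "\<E>' = (\<lambda>(g, D). (`) (\<phi> g) ` D) ` (carrier \<Gamma> \<times> \<E>)"
  have cE': "countable \<E>'" unfolding \<E>'_def using E(1) by auto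
  have dE': "dense D'" if D': "D' \<in> \<E>'" for D'
  proof -
    obtain g D where g: "g \<in> carrier \<Gamma>" "D \<in> \<E>" "D' = (`) (\<phi> g) ` D"
      using D' unfolding \<E>'_def by auto
    then have dD: "dense D" using E(2) by blast
    show ?thesis unfolding dense_def
    proof (intro conjI ballI)
      show "D' \<subseteq> N" using dD g act_N unfolding dense_def by blast
      fix H assume "H \<in> N"
      then have "\<phi> (inv\<^bsub>\<Gamma>\<^esub> g) ` H \<in> N" using act_N inv_in g(1) by blast
      then obtain F where "F \<in> D" "F \<subseteq> \<phi> (inv\<^bsub>\<Gamma>\<^esub> g) ` H" using dD unfolding dense_def by blast
      then have "\<phi> g ` F \<in> D'" "\<phi> g ` F \<subseteq> H" using g inv_act by auto
      then show "\<exists>F\<in>D'. F \<subseteq> H" by blast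
    qed
  qed
  obtain x where x: "x \<in> F'" "\<And>D'. D' \<in> \<E>' \<Longrightarrow> x \<in> \<Union>D'"
    using baire[OF cE' dE' F'(1)] by blast
  then obtain e where e: "e \<in> G" "rng e \<subseteq> F" "x \<in> rng e" using F'(2) unfolding verts_def by blast
  have "rng e \<subseteq> B"
  proof
    fix y assume y: "y \<in> rng e"
    obtain g where g: "g \<in> carrier \<Gamma>" "x = \<phi> g y" using same_orbit[OF y e(3,1) B(2)] .
    have "y \<in> \<Union>D" if "D \<in> \<E>" for D
    proof -
      have "(`) (\<phi> g) ` D \<in> \<E>'" unfolding \<E>'_def using that g(1) by force
      then obtain A where A: "A \<in> D" "x \<in> \<phi> g ` A" using x(2) by blast
      from A(2) obtain a where "a \<in> A" "x = \<phi> g a" by (rule imageE)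
      then have "y = a" using act_inv[OF g(1)] g(2) by metis
      then show ?thesis using A \<open>a \<in> A\<close> by blast
    qed
    then show "y \<in> B" using E(3) y e(2) by blast
  qed
  moreover have "G \<subseteq> seqs UNIV" by (intro analytic_in_subset_seqs analytic_graphs B(2))
  ultimately have "e \<in> seqs B" using seqs_iff_rng[of e B] e(1) by blast
  then show False using B(3) e(1) unfolding anticlique_def by blast
qed

text \<open>The Borel hull of \<open>E\<close> used here is disjoint from that of every member disjoint from \<open>E\<close>; so
  lying in the hulls decides the Suslin pieces of \<open>A\<close> consistently.\<close>

lemma borel_subset_of_member:
  assumes A: "A \<in> N"
  shows "\<exists>B\<in>sets borel - I. B \<subseteq> A"
proof -
  define lsep where "lsep E F = (SOME K. K \<in> sets borel \<and> E \<subseteq> K \<and> K \<inter> F = {})" for E F :: "'a set"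
  have lsep: "lsep E F \<in> sets borel" "E \<subseteq> lsep E F" "lsep E F \<inter> F = {}"
    if "E \<in> N" "F \<in> N" "E \<inter> F = {}" for E F
  proof -
    have "\<exists>K. K \<in> sets borel \<and> E \<subseteq> K \<and> K \<inter> F = {}"
      using lusin_separation[of E F] that N_analytic by blast
    from someI_ex[OF this] show "lsep E F \<in> sets borel" "E \<subseteq> lsep E F" "lsep E F \<inter> F = {}"
      unfolding lsep_def by blast+
  qed
  \<comment> \<open>\<open>lsep\<close> is not symmetric, and removing \<open>lsep F E\<close> is
    what makes hulls of disjoint members disjoint. The closure forces a point in the hulls along a
    branch to equal the limit of the branch. The double complement expresses an intersection that is
    vacuous when no member is disjoint from \<open>E\<close>.\<close>
  define bhull where "bhull E = closure E - (\<Union>F\<in>{F\<in>N. E \<inter> F = {}}. - (lsep E F - lsep F E))" for E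
  have hull_borel: "bhull E \<in> sets borel" if "E \<in> N" for E
    unfolding bhull_def
  proof (intro sets.Diff sets.countable_UN'')
    show "countable {F\<in>N. E \<inter> F = {}}" using countable_N by (auto intro: countable_subset)
    show "- (lsep E F - lsep F E) \<in> sets borel" if "F \<in> {F\<in>N. E \<inter> F = {}}" for F
      using that \<open>E \<in> N\<close> lsep(1)[of E F] lsep(1)[of F E] by (auto simp: Int_commute)
  qed simp
  have hull_sup: "E \<subseteq> bhull E" if "E \<in> N" for E
    using that lsep(2)[of E] lsep(3)[of _ E] closure_subset[of E] unfolding bhull_def by blast
  have hull_disj: "bhull E \<inter> bhull F = {}" if "E \<in> N" "F \<in> N" "E \<inter> F = {}" for E F
  proof -
    have "bhull E \<subseteq> lsep E F - lsep F E" "bhull F \<subseteq> lsep F E - lsep E F"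
      using that unfolding bhull_def by blast+
    then show ?thesis by blast
  qed
  define q where "q = bhull A \<inter> (\<Inter>u. \<Union>E\<in>piece_dense A u. bhull E)"
  have pdN: "piece_dense A u \<subseteq> N" for u by (auto simp: piece_dense_def)
  have "(\<Inter>u. \<Union>E\<in>piece_dense A u. bhull E) \<in> sets borel"
  proof (rule sets.countable_INT')
    show "(\<lambda>u. \<Union>E\<in>piece_dense A u. bhull E) ` UNIV \<subseteq> sets borel"
    proof (intro image_subsetI sets.countable_UN'')
      show "countable (piece_dense A u)" for u using pdN countable_N countable_subset by blast
      show "\<And>u E. E \<in> piece_dense A u \<Longrightarrow> bhull E \<in> sets borel" using pdN hull_borel by blast
    qed
  qed auto
  then have q_borel: "q \<in> sets borel" unfolding q_def using hull_borel[OF A] by blast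
  have generic: "{x\<in>A. \<forall>D\<in>range (piece_dense A). x \<in> \<Union>D} \<notin> I"
    using dense_piece_dense[OF A] by (intro generic_points_positive A) auto
  have sub: "{x\<in>A. \<forall>D\<in>range (piece_dense A). x \<in> \<Union>D} \<subseteq> q"
  proof
    fix x assume "x \<in> {x\<in>A. \<forall>D\<in>range (piece_dense A). x \<in> \<Union>D}"
    then have x: "x \<in> A" "\<And>u. x \<in> \<Union>(piece_dense A u)" by auto
    have "x \<in> (\<Union>E\<in>piece_dense A u. bhull E)" for u
    proof -
      obtain E where "E \<in> piece_dense A u" "x \<in> E" using x(2)[of u] by blast
      then show ?thesis using hull_sup[of E] pdN[of u] by blast
    qed
    then show "x \<in> q" unfolding q_def using x(1) hull_sup[OF A] by blast
  qed
  have "q \<notin> I"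
  proof
    assume "q \<in> I"
    from generic ideal_mono[OF this sub] show False by (rule notE)
  qed
  moreover have "q \<subseteq> A"
  proof
    fix x assume x: "x \<in> q"
    obtain z where z: "\<And>n. \<exists>E\<in>N. x \<in> bhull E \<and> E \<subseteq> piece A (map z [0..<n])"
    proof (rule branch_exists[of "\<lambda>u. \<exists>E\<in>N. x \<in> bhull E \<and> E \<subseteq> piece A u"])
      show "\<exists>E\<in>N. x \<in> bhull E \<and> E \<subseteq> piece A []"
        using x A piece_Nil[OF N_analytic[OF A]] by (intro bexI[of _ A]) (auto simp: q_def)
      fix u assume "\<exists>E\<in>N. x \<in> bhull E \<and> E \<subseteq> piece A u"
      then obtain E where E: "E \<in> N" "x \<in> bhull E" "E \<subseteq> piece A u" by blast
      obtain F where F: "F \<in> piece_dense A u" "x \<in> bhull F" using x unfolding q_def by blast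
      have "F \<in> N" using F(1) pdN by blast
      \<comment> \<open>The hulls share \<open>x\<close>, so the sets meet; as \<open>E\<close> is
        inside the current piece, \<open>F\<close> cannot avoid it and must have decided for a
        subpiece.\<close>
      then have "E \<inter> F \<noteq> {}" using hull_disj[of E F] E(1,2) F(2) by blast
      then have "F \<inter> piece A u \<noteq> {}" using E(3) by blast
      then obtain n where "F \<subseteq> piece A (u @ [n])" using F(1) unfolding piece_dense_def by blast
      then show "\<exists>n. \<exists>E\<in>N. x \<in> bhull E \<and> E \<subseteq> piece A (u @ [n])" using F(2) \<open>F \<in> N\<close> by blast
    qed blast
    have ne: "piece A (map z [0..<n]) \<noteq> {}" for n using z[of n] N_nonempty by blast
    obtain y where y: "y \<in> A" "\<And>V. open V \<Longrightarrow> y \<in> V \<Longrightarrow> \<exists>n. piece A (map z [0..<n]) \<subseteq> V"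
      using piece_limit[OF N_analytic[OF A] ne] by blast
    have "x = y"
    proof (rule ccontr)
      assume "x \<noteq> y"
      from hausdorff[OF this] obtain U V where UV: "open U" "open V" "x \<in> U" "y \<in> V" "U \<inter> V = {}"
        by blast
      obtain n where "piece A (map z [0..<n]) \<subseteq> V" using y(2) UV by blast
      then obtain E where E: "x \<in> closure E" "E \<subseteq> V" using z[of n] unfolding bhull_def by blast
      have "E \<subseteq> - U" using E UV by blast
      then have "closure E \<subseteq> - U" using UV(1) by (intro closure_minimal) (auto simp: closed_def)
      then show False using E UV(3) by blast
    qed
    then show "x \<in> A" using y(1) by simp
  qed
  ultimately show ?thesis using q_borel by blast
qed

end

section \<open>Families of Borel positive sets\<close>

context actionable
begin

lemma pos_has_borel_subset:
  assumes "A \<in> pos"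
  shows "\<exists>B\<in>positive_borel I. B \<subseteq> A"
proof -
  obtain N where "countable N" "N \<subseteq> pos" "A \<in> N" "closed_under reqs N"
    using countable_closed_under[OF countable_reqs closed_under_pos assms] .
  then interpret forcing_family I \<G> \<Gamma> \<phi> N by unfold_locales
  show ?thesis using borel_subset_of_member[OF \<open>A \<in> N\<close>] by (simp add: positive_borel_def)
qed

lemma positive_borel_subset_pos: "positive_borel I \<subseteq> pos"
  by (auto simp: positive_borel_def pos_def analytic_borel)

text \<open>Apart from translation, a requirement is inherited by subsets of the set that meets it,
  so a Borel positive subset of the analytic solution will do. Translation demands an equality, but
  translates of Borel sets are Borel.\<close>

lemma closed_under_positive_borel: "closed_under reqs (positive_borel I)"
  unfolding closed_under_def
proof (intro ballI)
  fix R x y assume R: "R \<in> reqs" and x: "x \<in> positive_borel I" and y: "y \<in> positive_borel I"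
  show "\<exists>z\<in>positive_borel I. R x y z"
  proof (cases "R \<in> (\<lambda>g E H H'. H' = \<phi> g ` H) ` carrier \<Gamma>")
    case True
    then show ?thesis using y borel_act_image ideal_act_iff by (auto simp: positive_borel_def)
  next
    case False
    obtain z where z: "z \<in> pos" "R x y z"
      using closed_under_pos R x y positive_borel_subset_pos unfolding closed_under_def by blast
    obtain B where B: "B \<in> positive_borel I" "B \<subseteq> z" using pos_has_borel_subset[OF z(1)] by blast
    have "R x y B" using False R z(2) B(2) unfolding reqs_def by blast
    then show ?thesis using B(1) by blast
  qed
qed

lemma borel_generic_condition:
  assumes N: "countable N" "N \<subseteq> positive_borel I" "closed_under reqs N" and p: "p \<in> N"
    and D: "countable \<D>" "\<And>D H. D \<in> \<D> \<Longrightarrow> H \<in> N \<Longrightarrow> \<exists>F\<in>D \<inter> N. F \<subseteq> H"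
  shows "\<exists>q\<in>positive_borel I. q \<subseteq> p \<and> (\<forall>D\<in>\<D>. q \<subseteq> \<Union>(D \<inter> N))"
proof -
  interpret forcing_family I \<G> \<Gamma> \<phi> N
    using N positive_borel_subset_pos by unfold_locales auto
  define q where "q = p - (\<Union>D\<in>\<D>. - \<Union>(D \<inter> N))"
  have "{x\<in>p. \<forall>D\<in>(\<lambda>D. D \<inter> N) ` \<D>. x \<in> \<Union>D} \<notin> I"
    using D by (intro generic_points_positive p) (auto simp: dense_def)
  moreover have "{x\<in>p. \<forall>D\<in>(\<lambda>D. D \<inter> N) ` \<D>. x \<in> \<Union>D} = q"
    unfolding q_def by auto
  ultimately have "q \<notin> I" by simp
  moreover have "q \<in> sets borel"
  proof -
    have "\<Union>(D \<inter> N) \<in> sets borel" for D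
      using N by (intro sets.countable_Union) (auto simp: positive_borel_def intro: countable_subset)
    then have "- \<Union>(D \<inter> N) \<in> sets borel" for D by (simp add: borel_comp)
    then show ?thesis unfolding q_def using N(2) p D(1)
      by (intro sets.Diff sets.countable_UN'') (auto simp: positive_borel_def)
  qed
  ultimately have "q \<in> positive_borel I" by (simp add: positive_borel_def)
  moreover have "q \<subseteq> p" "\<forall>D\<in>\<D>. q \<subseteq> \<Union>(D \<inter> N)" unfolding q_def by blast+
  ultimately show ?thesis by blast
qed

end

section \<open>Reflection in the structure of hereditarily small sets\<close>

definition relE :: "'u rel \<Rightarrow> 'u \<Rightarrow> 'u \<Rightarrow> 'u \<Rightarrow> bool" where
  "relE E f x y \<longleftrightarrow> (\<exists>z. (z, f) \<in> E \<and> is_pair E z x y)"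

definition triE :: "'u rel \<Rightarrow> 'u \<Rightarrow> 'u \<Rightarrow> 'u \<Rightarrow> 'u \<Rightarrow> bool" where
  "triE E r x y z \<longleftrightarrow> (\<exists>w. is_pair E w x y \<and> relE E r w z)"

text \<open>Applying \<open>ext E\<close> to the elements of \<open>z\<close> recovers the
  Kuratowski pair as a genuine set of sets, for which injectivity is a matter of doubletons.\<close>

lemma is_pair_inj:
  assumes "is_pair E z a b" "is_pair E z a' b'"
  shows "a = a'" "b = b'"
proof -
  have "ext E ` ext E z = {{a}, {a, b}}" if "is_pair E z a b" for a b
    using that unfolding is_pair_def by auto
  then have eq: "{{a}, {a, b}} = {{a'}, {a', b'}}" using assms by metis
  then show "a = a'" by (auto simp: doubleton_eq_iff)
  then show "b = b'" using eq by (auto simp: doubleton_eq_iff)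
qed

text \<open>Presents a countable set by a single function and a point, without an index set; both
  the internal notion of countability and the coding of countably many relations by two parameters
  rest on this.\<close>

lemma countable_orbit:
  assumes "countable S" "S \<noteq> {}"
  obtains s a where "a \<in> S" "s \<in> S \<rightarrow> S" "\<And>x. x \<in> S \<Longrightarrow> \<exists>n. (s ^^ n) a = x"
proof -
  \<comment> \<open>For finite \<open>S\<close>, the index after the last one is out of range; there
    \<open>from_nat_into\<close> still returns an element of \<open>S\<close>.\<close>
  define s where "s x = from_nat_into S (Suc (to_nat_on S x))" for x
  define a where "a = from_nat_into S 0"
  have "\<forall>x\<in>S. to_nat_on S x = n \<longrightarrow> (s ^^ n) a = x" for n
  proof (induction n)
    case 0
    then show ?case using assms by (auto simp: a_def) (metis from_nat_into_to_nat_on)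
  next
    case (Suc n)
    show ?case
    proof (intro ballI impI)
      fix x assume x: "x \<in> S" "to_nat_on S x = Suc n"
      have "n \<in> to_nat_on S ` S"
      proof (cases "finite S")
        case True
        have *: "to_nat_on S ` S = {..<card S}"
          using to_nat_on_finite[OF True] by (simp add: bij_betw_def)
        then have "Suc n \<in> {..<card S}" using x by (metis imageI)
        then show ?thesis unfolding * by simp
      next
        case False
        have "to_nat_on S ` S = UNIV"
          using to_nat_on_infinite[OF assms(1) False] by (simp add: bij_betw_def)
        then show ?thesis by simp
      qed
      then obtain y where y: "y \<in> S" "to_nat_on S y = n" by auto
      have "(s ^^ Suc n) a = s y" using Suc y by simp
      also have "\<dots> = x" unfolding s_def y(2) x(2)[symmetric] using assms(1) x(1) by simp
      finally show "(s ^^ Suc n) a = x" .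
    qed
  qed
  moreover have "a \<in> S" "s \<in> S \<rightarrow> S" using assms(2) by (auto simp: a_def s_def from_nat_into)
  ultimately show thesis using that[of a s] by blast
qed

section \<open>Formulas for closed, countable and generic sets\<close>

definition Imp :: "fm \<Rightarrow> fm \<Rightarrow> fm" where "Imp \<alpha> \<beta> = Neg (Conj \<alpha> (Neg \<beta>))"
definition Disj :: "fm \<Rightarrow> fm \<Rightarrow> fm" where "Disj \<alpha> \<beta> = Neg (Conj (Neg \<alpha>) (Neg \<beta>))"
definition Iff :: "fm \<Rightarrow> fm \<Rightarrow> fm" where "Iff \<alpha> \<beta> = Conj (Imp \<alpha> \<beta>) (Imp \<beta> \<alpha>)"
definition All :: "nat \<Rightarrow> fm \<Rightarrow> fm" where "All i \<alpha> = Neg (Exi i (Neg \<alpha>))"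

lemma sat_connectives [simp]:
  "sat U E (Imp \<alpha> \<beta>) v \<longleftrightarrow> (sat U E \<alpha> v \<longrightarrow> sat U E \<beta> v)"
  "sat U E (Disj \<alpha> \<beta>) v \<longleftrightarrow> (sat U E \<alpha> v \<or> sat U E \<beta> v)"
  "sat U E (Iff \<alpha> \<beta>) v \<longleftrightarrow> (sat U E \<alpha> v \<longleftrightarrow> sat U E \<beta> v)"
  "sat U E (All i \<alpha>) v \<longleftrightarrow> (\<forall>a\<in>U. sat U E \<alpha> (v(i := a)))"
  by (auto simp: Imp_def Disj_def Iff_def All_def)

text \<open>Variables from 100 on are reserved for the bound variables of the formulas for pairs.\<close>

definition PairF :: "nat \<Rightarrow> nat \<Rightarrow> nat \<Rightarrow> fm" where
  "PairF z a b = Exi 101 (Exi 102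
     (Conj (All 103 (Iff (Mem 103 101) (Eql 103 a)))
     (Conj (All 103 (Iff (Mem 103 102) (Disj (Eql 103 a) (Eql 103 b))))
           (All 103 (Iff (Mem 103 z) (Disj (Eql 103 101) (Eql 103 102)))))))"

definition RelF :: "nat \<Rightarrow> nat \<Rightarrow> nat \<Rightarrow> fm" where
  "RelF f x y = Exi 104 (Conj (Mem 104 f) (PairF 104 x y))"

definition TriF :: "nat \<Rightarrow> nat \<Rightarrow> nat \<Rightarrow> nat \<Rightarrow> fm" where
  "TriF r x y z = Exi 105 (Conj (PairF 105 x y) (RelF r 105 z))"

locale membership =
  fixes U :: "'u set" and E :: "'u rel"
  assumes E_subset: "E \<subseteq> U \<times> U"
begin

lemma ext_subset: "ext E a \<subseteq> U"
  using E_subset by (auto simp: ext_def)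

lemma in_ext: "x \<in> ext E a \<longleftrightarrow> (x, a) \<in> E"
  by (simp add: ext_def)

lemma sat_PairF [simp]:
  assumes "z \<notin> {101,102,103}" "a \<notin> {101,102,103}" "b \<notin> {101,102,103}" "v a \<in> U" "v b \<in> U"
  shows "sat U E (PairF z a b) v \<longleftrightarrow> is_pair E (v z) (v a) (v b)"
proof -
  have 1: "(\<forall>u\<in>U. (u, s) \<in> E \<longleftrightarrow> u = x \<or> u = y) \<longleftrightarrow> ext E s = {x, y}" if "x \<in> U" "y \<in> U" for s x y
    using that E_subset by (auto simp: ext_def)
  have 2: "(\<forall>u\<in>U. (u, s) \<in> E \<longleftrightarrow> u = x) \<longleftrightarrow> ext E s = {x}" if "x \<in> U" for s x
    using 1[OF that that] by simp
  have "sat U E (PairF z a b) v \<longleftrightarrow>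
    (\<exists>s\<in>U. \<exists>t\<in>U. ext E s = {v a} \<and> ext E t = {v a, v b} \<and> ext E (v z) = {s, t})"
    using assms by (simp add: PairF_def 1 2)
  also have "\<dots> \<longleftrightarrow> is_pair E (v z) (v a) (v b)"
    unfolding is_pair_def using ext_subset[of "v z"] by blast
  finally show ?thesis .
qed

lemma is_pair_in:
  assumes "is_pair E z a b"
  shows "a \<in> U" "b \<in> U" "z \<in> U"
proof -
  obtain s t where st: "ext E s = {a}" "ext E t = {a, b}" "ext E z = {s, t}"
    using assms unfolding is_pair_def by blast
  then have "(a, s) \<in> E" "(b, t) \<in> E" "(s, z) \<in> E" by (auto simp: ext_def)
  then show "a \<in> U" "b \<in> U" "z \<in> U" using E_subset by auto
qed

lemma relE_in: "relE E f x y \<Longrightarrow> x \<in> U \<and> y \<in> U"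
  unfolding relE_def using is_pair_in by blast

lemma sat_RelF [simp]:
  assumes "f \<notin> {101,102,103,104}" "x \<notin> {101,102,103,104}" "y \<notin> {101,102,103,104}" "v x \<in> U" "v y \<in> U"
  shows "sat U E (RelF f x y) v \<longleftrightarrow> relE E (v f) (v x) (v y)"
  using assms E_subset by (auto simp: RelF_def relE_def)

lemma sat_TriF [simp]:
  assumes "{r, x, y, z} \<inter> {101,102,103,104,105} = {}" "v x \<in> U" "v y \<in> U" "v z \<in> U"
  shows "sat U E (TriF r x y z) v \<longleftrightarrow> triE E (v r) (v x) (v y) (v z)"
  using assms is_pair_in(3) by (auto simp: TriF_def triE_def)

text \<open>The relations are themselves given by elements of \<open>X\<close>, so one formula
  expresses closure under all of them at once.\<close>

definition closedE :: "'u set \<Rightarrow> bool" where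
  "closedE X \<longleftrightarrow> (\<forall>r\<in>X. \<forall>x\<in>X. \<forall>y\<in>X. (\<exists>z\<in>U. triE E r x y z) \<longrightarrow> (\<exists>z\<in>X. triE E r x y z))"

text \<open>Countability of \<open>n\<close> is expressed without reference to omega: \<open>n\<close> is contained in every set that
  contains \<open>a\<close> and is closed under the partial function \<open>f\<close>.\<close>

definition countableE :: "'u \<Rightarrow> bool" where
  "countableE n \<longleftrightarrow> (\<exists>f\<in>U. \<exists>a\<in>U.
     (\<forall>x\<in>U. \<forall>y\<in>U. \<forall>y'\<in>U. relE E f x y \<and> relE E f x y' \<longrightarrow> y = y') \<and>
     (\<forall>S\<in>U. (a, S) \<in> E \<and> (\<forall>x\<in>U. \<forall>y\<in>U. (x, S) \<in> E \<and> relE E f x y \<longrightarrow> (y, S) \<in> E) \<longrightarrow>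
        (\<forall>x\<in>U. (x, n) \<in> E \<longrightarrow> (x, S) \<in> E)))"

text \<open>The conclusion of properness with \<open>X\<close> as the model, with conditions and
  dense sets replaced by their codes and all quantifiers bounded by \<open>U\<close>, so that it is
  a formula about the poset, its ordering and \<open>X\<close>.\<close>

definition genericE :: "'u \<Rightarrow> 'u \<Rightarrow> 'u set \<Rightarrow> bool" where
  "genericE P R X \<longleftrightarrow> (\<forall>p\<in>U. (p, P) \<in> E \<and> p \<in> X \<longrightarrow> (\<exists>q\<in>U. (q, P) \<in> E \<and> relE E R q p \<and>
     (\<forall>D\<in>U. D \<in> X \<and> (\<forall>x\<in>U. (x, D) \<in> E \<longrightarrow> (x, P) \<in> E) \<and>
        (\<forall>x\<in>U. (x, P) \<in> E \<longrightarrow> (\<exists>d\<in>U. (d, D) \<in> E \<and> relE E R d x)) \<longrightarrow>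
        (\<forall>r\<in>U. (r, P) \<in> E \<and> relE E R r q \<longrightarrow> (\<exists>d\<in>U. (d, D) \<in> E \<and> d \<in> X \<and>
           (\<exists>s\<in>U. (s, P) \<in> E \<and> relE E R s d \<and> relE E R s r))))))"

text \<open>The variables 0 to 4 stand for the poset, its ordering, the two parameters of the club, and
  a candidate for a member of the club.\<close>

definition ClosedF :: fm where
  "ClosedF = All 30 (All 31 (All 32
     (Imp (Conj (Mem 30 4) (Conj (Mem 31 4) (Conj (Mem 32 4) (Exi 33 (TriF 30 31 32 33)))))
          (Exi 33 (Conj (Mem 33 4) (TriF 30 31 32 33))))))"

definition CountableF :: fm where
  "CountableF = Exi 20 (Exi 21 (Conj
     (All 22 (All 23 (All 24 (Imp (Conj (RelF 20 22 23) (RelF 20 22 24)) (Eql 23 24)))))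
     (All 25 (Imp (Conj (Mem 21 25)
                 (All 22 (All 23 (Imp (Conj (Mem 22 25) (RelF 20 22 23)) (Mem 23 25)))))
        (All 22 (Imp (Mem 22 4) (Mem 22 25)))))))"

definition GenericF :: fm where
  "GenericF = All 5 (Imp (Conj (Mem 5 0) (Mem 5 4)) (Exi 6 (Conj (Mem 6 0) (Conj (RelF 1 6 5)
     (All 7 (Imp (Conj (Mem 7 4) (Conj (All 8 (Imp (Mem 8 7) (Mem 8 0)))
        (All 8 (Imp (Mem 8 0) (Exi 9 (Conj (Mem 9 7) (RelF 1 9 8)))))))
        (All 8 (Imp (Conj (Mem 8 0) (RelF 1 8 6)) (Exi 9 (Conj (Mem 9 7) (Conj (Mem 9 4)
           (Exi 10 (Conj (Mem 10 0) (Conj (RelF 1 10 9) (RelF 1 10 8)))))))))))))))"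

text \<open>Besides the poset and its ordering only the two parameters are free; binding them
  existentially gives the sentence about the poset that is reflected.\<close>

definition ClubF :: fm where
  "ClubF = All 4 (Imp (Conj CountableF (Conj (Mem 2 4) (Conj (Mem 3 4) ClosedF))) GenericF)"

lemma sat_ClosedF:
  assumes "range v \<subseteq> U"
  shows "sat U E ClosedF v \<longleftrightarrow> closedE (ext E (v 4))"
proof -
  have "sat U E ClosedF v \<longleftrightarrow> (\<forall>r\<in>U. \<forall>x\<in>U. \<forall>y\<in>U. (r, v 4) \<in> E \<and> (x, v 4) \<in> E \<and> (y, v 4) \<in> E \<and>
    (\<exists>z\<in>U. triE E r x y z) \<longrightarrow> (\<exists>z\<in>U. (z, v 4) \<in> E \<and> triE E r x y z))"
    by (simp add: ClosedF_def)
  also have "\<dots> \<longleftrightarrow> closedE (ext E (v 4))"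
    unfolding closedE_def in_ext[symmetric] using ext_subset[of "v 4"] by blast
  finally show ?thesis .
qed

lemma sat_CountableF: "sat U E CountableF v \<longleftrightarrow> countableE (v 4)"
  unfolding CountableF_def countableE_def sat_connectives sat.simps
  by (intro bex_cong ball_cong arg_cong2[where f="(\<and>)"] arg_cong2[where f="(\<longrightarrow>)"] refl) simp_all

lemma sat_GenericF:
  assumes "range v \<subseteq> U"
  shows "sat U E GenericF v \<longleftrightarrow> genericE (v 0) (v 1) (ext E (v 4))"
  unfolding GenericF_def genericE_def sat_connectives sat.simps in_ext
  by (intro bex_cong ball_cong arg_cong2[where f="(\<and>)"] arg_cong2[where f="(\<longrightarrow>)"] refl) simp_all

lemma sat_ClubF:
  assumes "range v \<subseteq> U"
  shows "sat U E ClubF v \<longleftrightarrow> (\<forall>n\<in>U. countableE n \<and> v 2 \<in> ext E n \<and> v 3 \<in> ext E n \<and> closedE (ext E n)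
    \<longrightarrow> genericE (v 0) (v 1) (ext E n))"
proof -
  have "range (v(4 := n)) \<subseteq> U" if "n \<in> U" for n using assms that by auto
  then show ?thesis by (simp add: ClubF_def sat_ClosedF sat_CountableF sat_GenericF in_ext)
qed

end

section \<open>Coding small sets and relations by elements\<close>

locale hereditary = 
  fixes \<theta> :: "'u rel" and U :: "'u set" and E :: "'u rel"
  assumes is_H: "is_H \<theta> U E"
begin

sublocale membership U E
  using is_H by unfold_locales (simp add: is_H_def)

lemma infinite_Field: "\<not> finite (Field \<theta>)"
proof -
  have "natLeq \<le>o \<theta>" using is_H ordLess_imp_ordLeq unfolding is_H_def by blast
  then show ?thesis using cinfinite_mono natLeq_cinfinite unfolding cinfinite_def by blast
qed

lemma card_le: "|A| \<le>o |B| \<Longrightarrow> |B| <o \<theta> \<Longrightarrow> |A| <o \<theta>"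
  by (rule ordLeq_ordLess_trans)

lemma countable_small: "countable A \<Longrightarrow> |A| <o \<theta>"
  using countable_card_le_natLeq is_H ordLeq_ordLess_trans unfolding is_H_def by blast

lemma Times_small:
  assumes "|A| <o \<theta>" "|B| <o \<theta>"
  shows "|A \<times> B| <o \<theta>"
proof (cases "finite A \<and> finite B")
  case True
  then show ?thesis by (intro countable_small countable_finite) simp
next
  case False
  have C: "Card_order \<theta>" using is_H by (simp add: is_H_def)
  have "|A <+> B| <o \<theta>"
    using card_of_Plus_ordLess_infinite_Field[OF infinite_Field C assms] .
  moreover have "|A \<times> B| \<le>o |A <+> B|"
  proof -
    have inf: "\<not> finite (A <+> B)" using False by simp
    have "|A \<times> B| \<le>o |(A <+> B) \<times> (A <+> B)|"
      by (intro ordLeq_transitive[OF card_of_Times_mono1 card_of_Times_mono2] card_of_Plus1 card_of_Plus2)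
    also have "|(A <+> B) \<times> (A <+> B)| =o |A <+> B|" using card_of_Times_same_infinite[OF inf] .
    finally show ?thesis .
  qed
  ultimately show ?thesis by (rule card_le[rotated])
qed

lemma code_exists:
  assumes "A \<subseteq> U" "|A| <o \<theta>"
  obtains a where "a \<in> U" "ext E a = A"
proof -
  have "A \<in> ext E ` U" using is_H assms unfolding is_H_def bij_betw_def by blast
  then show thesis using that by blast
qed

lemma ext_inj: "inj_on (ext E) U"
  using is_H unfolding is_H_def bij_betw_def by blast

lemma pair_exists:
  assumes "a \<in> U" "b \<in> U"
  shows "\<exists>z\<in>U. is_pair E z a b"
proof -
  have small: "|A| <o \<theta>" if "finite A" for A :: "'u set" using that by (intro countable_small countable_finite)
  obtain s where s: "s \<in> U" "ext E s = {a}"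
    by (rule code_exists[of "{a}"]) (use assms small in auto)
  obtain t where t: "t \<in> U" "ext E t = {a, b}"
    by (rule code_exists[of "{a, b}"]) (use assms small in auto)
  obtain z where "z \<in> U" "ext E z = {s, t}"
    by (rule code_exists[of "{s, t}"]) (use s t small in auto)
  then show ?thesis using s t unfolding is_pair_def by blast
qed

definition pairE :: "'u \<Rightarrow> 'u \<Rightarrow> 'u" where
  "pairE a b = (SOME z. z \<in> U \<and> is_pair E z a b)"

lemma pairE:
  assumes "a \<in> U" "b \<in> U"
  shows "pairE a b \<in> U" "is_pair E (pairE a b) a b"
proof -
  have "\<exists>z. z \<in> U \<and> is_pair E z a b" using pair_exists[OF assms] by blast
  from someI_ex[OF this] show "pairE a b \<in> U" "is_pair E (pairE a b) a b"
    unfolding pairE_def by auto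
qed

lemma relation_code:
  assumes "T \<subseteq> U \<times> U" "|T| <o \<theta>"
  obtains f where "f \<in> U" "\<And>x y. relE E f x y \<longleftrightarrow> (x, y) \<in> T"
proof -
  have "|case_prod pairE ` T| <o \<theta>" by (rule card_le[OF card_of_image assms(2)])
  moreover have "case_prod pairE ` T \<subseteq> U" using assms(1) pairE(1) by auto
  ultimately obtain f where f: "f \<in> U" "ext E f = case_prod pairE ` T" by (metis code_exists)
  have "relE E f x y \<longleftrightarrow> (x, y) \<in> T" for x y
  proof
    assume "relE E f x y"
    then obtain z where "z \<in> ext E f" "is_pair E z x y" unfolding relE_def in_ext by blast
    then obtain x' y' where T: "(x', y') \<in> T" "z = pairE x' y'" using f by auto
    then have "is_pair E z x' y'" using pairE(2) assms(1) by blast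
    then show "(x, y) \<in> T" using is_pair_inj[OF \<open>is_pair E z x y\<close>] T(1) by simp
  next
    assume T: "(x, y) \<in> T"
    then have "is_pair E (pairE x y) x y" using pairE(2) assms(1) by blast
    moreover have "pairE x y \<in> ext E f" using T f by force
    ultimately show "relE E f x y" unfolding relE_def in_ext by blast
  qed
  then show thesis using f(1) that by blast
qed

lemma ternary_relation_code:
  assumes "T \<subseteq> U \<times> U \<times> U" "|T| <o \<theta>"
  obtains f where "f \<in> U" "\<And>x y z. triE E f x y z \<longleftrightarrow> (x, y, z) \<in> T"
proof -
  define T' where "T' = (\<lambda>(x, y, z). (pairE x y, z)) ` T"
  have "|T'| <o \<theta>" unfolding T'_def by (rule card_le[OF card_of_image assms(2)])
  moreover have "T' \<subseteq> U \<times> U" using assms(1) pairE(1) by (auto simp: T'_def)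
  ultimately obtain f where f: "f \<in> U" "\<And>x y. relE E f x y \<longleftrightarrow> (x, y) \<in> T'" by (metis relation_code)
  have "triE E f x y z \<longleftrightarrow> (x, y, z) \<in> T" for x y z
  proof
    assume "triE E f x y z"
    then obtain w where w: "is_pair E w x y" "(w, z) \<in> T'" unfolding triE_def f(2) by blast
    then obtain x' y' where T: "(x', y', z) \<in> T" "w = pairE x' y'" unfolding T'_def by auto
    then have "is_pair E w x' y'" using pairE(2) assms(1) by blast
    then show "(x, y, z) \<in> T" using is_pair_inj[OF w(1)] T(1) by simp
  next
    assume T: "(x, y, z) \<in> T"
    then have "is_pair E (pairE x y) x y" using pairE(2) assms(1) by blast
    moreover have "(pairE x y, z) \<in> T'" using T unfolding T'_def by force
    ultimately show "triE E f x y z" unfolding triE_def f(2) by blast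
  qed
  then show thesis using f(1) that by blast
qed

text \<open>The sets that \<open>countableE\<close> quantifies over are elements of \<open>U\<close>
  only. This is enough because the orbit of the starting point is countable and therefore one of
  them.\<close>

lemma countableE_iff:
  assumes n: "n \<in> U"
  shows "countableE n \<longleftrightarrow> countable (ext E n)"
proof
  assume "countableE n"
  then obtain f a where f: "f \<in> U" "a \<in> U"
    and func: "\<And>x y y'. relE E f x y \<Longrightarrow> relE E f x y' \<Longrightarrow> y = y'"
    and min: "\<And>S. S \<in> U \<Longrightarrow> a \<in> ext E S \<Longrightarrow> (\<And>x y. x \<in> ext E S \<Longrightarrow> relE E f x y \<Longrightarrow> y \<in> ext E S)
      \<Longrightarrow> ext E n \<subseteq> ext E S"
    unfolding countableE_def in_ext subset_iff using relE_in E_subset by (smt (verit) SigmaD1 in_ext subset_iff)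
  \<comment> \<open>The default value \<open>a\<close> makes the partial function total without
    leaving \<open>U\<close>; the orbit of \<open>a\<close> under \<open>g\<close> is still closed
    under the relation coded by \<open>f\<close>.\<close>
  define g where "g x = (if \<exists>y. relE E f x y then THE y. relE E f x y else a)" for x
  have g: "g x = y" if "relE E f x y" for x y
    using that func by (auto simp: g_def)
  have gU: "g x \<in> U" for x
    using g relE_in f(2) unfolding g_def by (metis (no_types, lifting))
  define A where "A = range (\<lambda>k. (g ^^ k) a)"
  have "(g ^^ k) a \<in> U" for k by (cases k) (use f gU in auto)
  then have "A \<subseteq> U" unfolding A_def by auto
  moreover have cA: "countable A" unfolding A_def by auto
  ultimately obtain S where S: "S \<in> U" "ext E S = A" using code_exists countable_small by metis
  have "ext E n \<subseteq> ext E S"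
  proof (rule min[OF S(1)])
    show "a \<in> ext E S" unfolding S(2) A_def by (metis funpow_0 rangeI)
    fix x y assume "x \<in> ext E S" "relE E f x y"
    then obtain k where "x = (g ^^ k) a" "g x = y" using g unfolding S(2) A_def by auto
    then have "y = (g ^^ Suc k) a" by simp
    then show "y \<in> ext E S" unfolding S(2) A_def by blast
  qed
  then show "countable (ext E n)" using cA S(2) countable_subset by metis
next
  assume cn: "countable (ext E n)"
  show "countableE n"
  proof (cases "ext E n = {}")
    \<comment> \<open>There is no starting point inside \<open>n\<close>; the empty relation and any
      element of \<open>U\<close>, here \<open>n\<close>, serve.\<close>
    case True
    obtain f where f: "f \<in> U" "\<And>x y. relE E f x y \<longleftrightarrow> (x, y) \<in> {}"
      using relation_code[of "{}"] countable_small[of "{}"] by auto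
    then show ?thesis using n True unfolding countableE_def
      by (intro bexI[of _ f] bexI[of _ n]) (auto simp: in_ext[symmetric])
  next
    case False
    obtain s a where s: "a \<in> ext E n" "s \<in> ext E n \<rightarrow> ext E n"
      "\<And>x. x \<in> ext E n \<Longrightarrow> \<exists>k. (s ^^ k) a = x" using countable_orbit[OF cn False] by metis
    define T where "T = (\<lambda>x. (x, s x)) ` ext E n"
    have "T \<subseteq> U \<times> U" unfolding T_def using s(2) ext_subset[of n] by auto
    moreover have "|T| <o \<theta>" using cn unfolding T_def by (intro countable_small) simp
    ultimately obtain f where f: "f \<in> U" "\<And>x y. relE E f x y \<longleftrightarrow> (x, y) \<in> T" using relation_code by metis
    show ?thesis unfolding countableE_def
    proof (rule bexI[OF _ f(1)], rule bexI[of _ a], intro conjI ballI impI)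
      show "y = y'" if "relE E f x y \<and> relE E f x y'" for x y y'
        using that unfolding f(2) T_def by auto
      fix S x assume S: "S \<in> U" "(a, S) \<in> E \<and> (\<forall>x\<in>U. \<forall>y\<in>U. (x, S) \<in> E \<and> relE E f x y \<longrightarrow> (y, S) \<in> E)"
        and x: "x \<in> U" "(x, n) \<in> E"
      have "(s ^^ k) a \<in> ext E n \<and> ((s ^^ k) a, S) \<in> E" for k
      proof (induction k)
        case 0
        then show ?case using s(1) S(2) by simp
      next
        case (Suc k)
        then have "s ((s ^^ k) a) \<in> ext E n" "relE E f ((s ^^ k) a) (s ((s ^^ k) a))"
          using s(2) unfolding f(2) T_def by auto
        then show ?case using S(2) Suc ext_subset[of n] by (auto simp: subset_iff)
      qed
      then show "(x, S) \<in> E" using s(3)[of x] x by (auto simp: in_ext)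
    next
      show "a \<in> U" using s(1) ext_subset[of n] by blast
    qed
  qed
qed

text \<open>The codes of the relations in \<open>\<T>\<close> are the orbit of \<open>a\<close> under the function coded by \<open>r\<close>, so a
  closed set containing \<open>r\<close> and \<open>a\<close> contains all of them.\<close>

lemma club_parameters:
  assumes "countable \<T>" "\<T> \<noteq> {}" "\<And>T. T \<in> \<T> \<Longrightarrow> T \<subseteq> U \<times> U \<times> U" "\<And>T. T \<in> \<T> \<Longrightarrow> |T| <o \<theta>"
  obtains r a where "r \<in> U" "a \<in> U"
    "\<forall>X\<subseteq>U. closedE X \<and> r \<in> X \<and> a \<in> X \<longrightarrow>
      (\<forall>T\<in>\<T>. \<forall>x\<in>X. \<forall>y\<in>X. (\<exists>z. (x, y, z) \<in> T) \<longrightarrow> (\<exists>z\<in>X. (x, y, z) \<in> T))"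
proof -
  have "\<forall>T\<in>\<T>. \<exists>f. f \<in> U \<and> (\<forall>x y z. triE E f x y z \<longleftrightarrow> (x, y, z) \<in> T)"
    using assms(3,4) ternary_relation_code by metis
  then obtain k where k: "\<And>T. T \<in> \<T> \<Longrightarrow> k T \<in> U" "\<And>T x y z. T \<in> \<T> \<Longrightarrow> triE E (k T) x y z \<longleftrightarrow> (x, y, z) \<in> T"
    by metis
  obtain s a where s: "a \<in> k ` \<T>" "s \<in> k ` \<T> \<rightarrow> k ` \<T>" "\<And>x. x \<in> k ` \<T> \<Longrightarrow> \<exists>n. (s ^^ n) a = x"
    using countable_orbit[of "k ` \<T>"] assms(1,2) by (metis countable_image image_is_empty)
  \<comment> \<open>The unary function is padded to a ternary relation, the kind that
    \<open>closedE\<close> refers to.\<close>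
  define T0 where "T0 = (\<lambda>x. (x, x, s x)) ` k ` \<T>"
  have kU: "k ` \<T> \<subseteq> U" using k(1) by blast
  then have "T0 \<subseteq> U \<times> U \<times> U" using s(2) unfolding T0_def by auto
  moreover have "|T0| <o \<theta>" unfolding T0_def using assms(1) by (intro countable_small countable_image)
  ultimately obtain r where r: "r \<in> U" "\<And>x y z. triE E r x y z \<longleftrightarrow> (x, y, z) \<in> T0"
    using ternary_relation_code by metis
  show thesis
  proof (rule that[of r a], goal_cases)
    case 1
    show ?case by (rule r(1))
  next
    case 2
    show ?case using s(1) kU by blast
  next
    case 3
    show ?case
    proof (intro allI ballI impI, elim conjE)
      fix X T x y
      assume X: "closedE X" "X \<subseteq> U" "r \<in> X" "a \<in> X" and T: "T \<in> \<T>" and xy: "x \<in> X" "y \<in> X" "\<exists>z. (x, y, z) \<in> T"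
      have "(s ^^ n) a \<in> X \<and> (s ^^ n) a \<in> k ` \<T>" for n
      proof (induction n)
        case 0
        then show ?case using X s by simp
      next
        case (Suc n)
        define b where "b = (s ^^ n) a"
        have b: "b \<in> X" "b \<in> k ` \<T>" using Suc by (auto simp: b_def)
        have sb: "s b \<in> k ` \<T>" using b(2) s(2) by blast
        have "triE E r b b (s b)" unfolding r(2) T0_def using b(2) by blast
        then have "\<exists>z\<in>X. triE E r b b z"
          using X(1,3) b(1) sb kU unfolding closedE_def by blast
        then have "s b \<in> X" unfolding r(2) T0_def by auto
        then show ?case using sb by (simp add: b_def)
      qed
      moreover obtain n where "(s ^^ n) a = k T" using s(3)[of "k T"] T by blast
      ultimately have "k T \<in> X" by metis
      moreover have "\<exists>z\<in>U. triE E (k T) x y z" using xy(3) k(2)[OF T] assms(3)[OF T] by blast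
      ultimately have "\<exists>z\<in>X. triE E (k T) x y z" using X(1) xy(1,2) unfolding closedE_def by blast
      then show "\<exists>z\<in>X. (x, y, z) \<in> T" using k(2)[OF T] by simp
    qed
  qed
qed

lemma closedE_elementary:
  assumes "elementary_submodel M U E"
  shows "closedE M"
  unfolding closedE_def
proof (intro ballI impI)
  fix r x y assume M: "r \<in> M" "x \<in> M" "y \<in> M" and ex: "\<exists>z\<in>U. triE E r x y z"
  have sub: "M \<subseteq> U" using assms by (simp add: elementary_submodel_def)
  have "x \<in> U" "y \<in> U" using M sub by auto
  define v where "v = (\<lambda>_::nat. r)(2 := x, 3 := y)"
  have v: "range v \<subseteq> M" using M by (auto simp: v_def)
  have "sat U E (Exi 4 (TriF 0 2 3 4)) v" using ex \<open>x \<in> U\<close> \<open>y \<in> U\<close> by (simp add: v_def)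
  then have "sat M E (Exi 4 (TriF 0 2 3 4)) v"
    using assms v unfolding elementary_submodel_def by blast
  then obtain z where z: "z \<in> M" "sat M E (TriF 0 2 3 4) (v(4 := z))" by auto
  have "range (v(4 := z)) \<subseteq> M" using v z(1) by auto
  \<comment> \<open>The meaning of \<open>TriF\<close> is established over \<open>U\<close>, so
    elementarity is used a second time to bring the formula with its witness back from
    \<open>M\<close>.\<close>
  then have "sat U E (TriF 0 2 3 4) (v(4 := z))"
    using assms z(2) unfolding elementary_submodel_def by blast
  moreover have "z \<in> U" using z(1) sub by blast
  ultimately have "triE E r x y z" using \<open>x \<in> U\<close> \<open>y \<in> U\<close> by (simp add: v_def)
  then show "\<exists>z\<in>M. triE E r x y z" using z(1) by blast
qed

text \<open>The parameters of the club of good countable sets can be found in \<open>M\<close> by elementarity, and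
  \<open>M\<close> itself is coded by an element of \<open>U\<close>.\<close>

lemma reflect_generic:
  assumes M: "elementary_submodel M U E" "countable M" "P \<in> M" "R \<in> M"
    and ra: "r \<in> U" "a \<in> U"
    and club: "\<And>X. X \<subseteq> U \<Longrightarrow> countable X \<Longrightarrow> closedE X \<Longrightarrow> r \<in> X \<Longrightarrow> a \<in> X \<Longrightarrow> genericE P R X"
  shows "genericE P R M"
proof -
  have sub: "M \<subseteq> U" using M by (simp add: elementary_submodel_def)
  define v where "v = (\<lambda>_::nat. P)(1 := R)"
  have v: "range v \<subseteq> M" using M by (auto simp: v_def)
  have rv: "range (v(2 := r', 3 := a')) \<subseteq> U" if "r' \<in> U" "a' \<in> U" for r' a'
    using v sub that by auto
  have "sat U E ClubF (v(2 := r, 3 := a))"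
    unfolding sat_ClubF[OF rv[OF ra]] using club ext_subset countableE_iff by (simp add: v_def)
  then have "sat U E (Exi 2 (Exi 3 ClubF)) v" using ra by auto
  then have "sat M E (Exi 2 (Exi 3 ClubF)) v"
    using M(1) v unfolding elementary_submodel_def by blast
  then obtain r' a' where ra': "r' \<in> M" "a' \<in> M" "sat M E ClubF (v(2 := r', 3 := a'))" by auto
  have "range (v(2 := r', 3 := a')) \<subseteq> M" using v ra'(1,2) by auto
  then have "sat U E ClubF (v(2 := r', 3 := a'))"
    using M(1) ra'(3) unfolding elementary_submodel_def by blast
  moreover have "r' \<in> U" "a' \<in> U" using ra' sub by auto
  ultimately have club': "countableE n \<and> r' \<in> ext E n \<and> a' \<in> ext E n \<and> closedE (ext E n) \<longrightarrow> genericE P R (ext E n)"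
    if "n \<in> U" for n
    using sat_ClubF[OF rv, of r' a'] that by (simp add: v_def)
  obtain n where n: "n \<in> U" "ext E n = M" using code_exists[OF sub countable_small[OF M(2)]] .
  show ?thesis
    using club'[OF n(1)] countableE_iff[OF n(1)] n(2) M(2) ra'(1,2) closedE_elementary[OF M(1)] by simp
qed

end

section \<open>Properness\<close>

context hereditary
begin

lemma relE_poset:
  assumes "poset_in U E P leq c P' R'" "p \<in> P" "q \<in> P"
  shows "relE E R' (c q) (c p) \<longleftrightarrow> leq q p"
proof
  assume "relE E R' (c q) (c p)"
  then obtain z where z: "z \<in> ext E R'" "is_pair E z (c q) (c p)" unfolding relE_def in_ext by blast
  then obtain q' p' where "q' \<in> P" "p' \<in> P" "leq q' p'" "is_pair E z (c q') (c p')"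
    using assms(1) unfolding poset_in_def by auto
  moreover from this have "c q = c q'" "c p = c p'" using is_pair_inj[OF z(2)] by auto
  ultimately show "leq q p" using assms unfolding poset_in_def inj_on_def by metis
next
  assume "leq q p"
  moreover have "c q \<in> U" "c p \<in> U" using assms unfolding poset_in_def by auto
  then obtain z where "is_pair E z (c q) (c p)" using pair_exists by blast
  ultimately have "z \<in> ext E R'" "is_pair E z (c q) (c p)"
    using assms unfolding poset_in_def by auto
  then show "relE E R' (c q) (c p)" unfolding relE_def in_ext by blast
qed

text \<open>Translates between dense sets of conditions and their codes in \<open>X\<close> via
  \<open>c\<close>; the right-hand side is the inner part of \<open>genericE\<close> for the
  condition \<open>c q\<close>.\<close>

lemma generic_condition_iff:
  assumes P: "poset_in U E P leq c P' R'" and X: "X \<subseteq> U" and q: "q \<in> P"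
  shows "generic_condition X E P leq c q \<longleftrightarrow>
    (\<forall>D\<in>U. D \<in> X \<and> (\<forall>x\<in>U. (x, D) \<in> E \<longrightarrow> (x, P') \<in> E) \<and>
        (\<forall>x\<in>U. (x, P') \<in> E \<longrightarrow> (\<exists>d\<in>U. (d, D) \<in> E \<and> relE E R' d x)) \<longrightarrow>
        (\<forall>r\<in>U. (r, P') \<in> E \<and> relE E R' r (c q) \<longrightarrow> (\<exists>d\<in>U. (d, D) \<in> E \<and> d \<in> X \<and>
           (\<exists>s\<in>U. (s, P') \<in> E \<and> relE E R' s d \<and> relE E R' s r))))" (is "_ \<longleftrightarrow> ?R")
proof -
  have cU: "\<And>p. p \<in> P \<Longrightarrow> c p \<in> U" and P': "\<And>x. (x, P') \<in> E \<longleftrightarrow> x \<in> c ` P" and inj: "inj_on c P"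
    using P unfolding poset_in_def in_ext[symmetric] by auto
  note rel = relE_poset[OF P]
  show ?thesis
  proof
    assume gen: "generic_condition X E P leq c q"
    show ?R
    proof (intro ballI impI, elim conjE)
      fix D r assume D: "D \<in> U" "D \<in> X" "\<forall>x\<in>U. (x, D) \<in> E \<longrightarrow> (x, P') \<in> E"
        "\<forall>x\<in>U. (x, P') \<in> E \<longrightarrow> (\<exists>d\<in>U. (d, D) \<in> E \<and> relE E R' d x)"
        and r: "r \<in> U" "(r, P') \<in> E" "relE E R' r (c q)"
      define D0 where "D0 = {d\<in>P. (c d, D) \<in> E}"
      have ext_D: "ext E D = c ` D0"
      proof (intro equalityI subsetI)
        fix x assume "x \<in> ext E D"
        then have "(x, D) \<in> E" "x \<in> U" using ext_subset[of D] by (auto simp: in_ext)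
        then obtain d where "d \<in> P" "x = c d" using D(3) P' by blast
        then show "x \<in> c ` D0" using \<open>(x, D) \<in> E\<close> unfolding D0_def by blast
      qed (auto simp: D0_def in_ext)
      have "\<exists>d\<in>D0. leq d p" if p: "p \<in> P" for p
      proof -
        obtain x where "x \<in> ext E D" "relE E R' x (c p)" using D(4) cU[OF p] P' p unfolding in_ext by blast
        moreover from this(1) obtain d where "d \<in> D0" "x = c d" unfolding ext_D by blast
        moreover from this(1) have "d \<in> P" by (simp add: D0_def)
        ultimately show ?thesis using rel[OF p, of d] by blast
      qed
      moreover have "D0 \<subseteq> P" by (auto simp: D0_def)
      ultimately have "dense_in P leq D0" unfolding dense_in_def by blast
      moreover obtain r0 where r0: "r0 \<in> P" "r = c r0" using r(2) P' by blast
      moreover have "leq r0 q" using r(3) r0 rel[OF q] by blast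
      ultimately obtain d where d: "d \<in> D0" "c d \<in> X" "compatible P leq d r0"
        using gen D(2) ext_D unfolding generic_condition_def by blast
      then obtain s where s: "s \<in> P" "leq s d" "leq s r0" unfolding compatible_def by blast
      have dP: "d \<in> P" "(c d, D) \<in> E" using d(1) by (auto simp: D0_def)
      have "relE E R' (c s) (c d)" "relE E R' (c s) r" using rel s dP r0 by auto
      then show "\<exists>d\<in>U. (d, D) \<in> E \<and> d \<in> X \<and> (\<exists>s\<in>U. (s, P') \<in> E \<and> relE E R' s d \<and> relE E R' s r)"
        using dP d(2) s(1) cU P' by blast
    qed
  next
    assume R: ?R
    show "generic_condition X E P leq c q"
      unfolding generic_condition_def
    proof (intro conjI q allI impI ballI, elim conjE bexE)
      fix D r D' assume D: "dense_in P leq D" "D' \<in> X" "ext E D' = c ` D" and r: "r \<in> P" "leq r q"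
      have DP: "D \<subseteq> P" using D(1) unfolding dense_in_def by blast
      have D': "(x, D') \<in> E \<longleftrightarrow> x \<in> c ` D" for x using D(3) in_ext by metis
      have "\<forall>x\<in>U. (x, D') \<in> E \<longrightarrow> (x, P') \<in> E" unfolding D' P' using DP by blast
      moreover have "\<forall>x\<in>U. (x, P') \<in> E \<longrightarrow> (\<exists>d\<in>U. (d, D') \<in> E \<and> relE E R' d x)"
      proof (intro ballI impI)
        fix x assume "(x, P') \<in> E"
        then obtain p where p: "p \<in> P" "x = c p" using P' by blast
        then obtain d where "d \<in> D" "leq d p" using D(1) unfolding dense_in_def by blast
        then show "\<exists>d\<in>U. (d, D') \<in> E \<and> relE E R' d x"
          using rel[of p d] p DP cU unfolding D' by blast
      qed
      moreover have "relE E R' (c r) (c q)" using rel[OF q r(1)] r(2) by blast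
      ultimately obtain x y where x: "x \<in> X" "(x, D') \<in> E" and y: "(y, P') \<in> E" "relE E R' y x" "relE E R' y (c r)"
        using R D(2) X cU[OF r(1)] r(1) P' by blast
      obtain d where d: "d \<in> D" "x = c d" using x(2) D' by blast
      obtain s where s: "s \<in> P" "y = c s" using y(1) P' by blast
      have "leq s d" "leq s r" using y d s rel[of d s] rel[OF r(1), of s] DP by auto
      then show "\<exists>d\<in>D. c d \<in> X \<and> compatible P leq d r"
        using d x(1) s(1) unfolding compatible_def by blast
    qed
  qed
qed

lemma genericE_iff:
  assumes P: "poset_in U E P leq c P' R'" and X: "X \<subseteq> U"
  shows "genericE P' R' X \<longleftrightarrow>
    (\<forall>p\<in>P. c p \<in> X \<longrightarrow> (\<exists>q\<in>P. leq q p \<and> generic_condition X E P leq c q))"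
proof -
  have cU: "\<And>p. p \<in> P \<Longrightarrow> c p \<in> U" and P': "\<And>x. (x, P') \<in> E \<longleftrightarrow> x \<in> c ` P"
    using P unfolding poset_in_def in_ext[symmetric] by auto
  have all: "(\<forall>x\<in>U. (x, P') \<in> E \<and> x \<in> X \<longrightarrow> Q x) \<longleftrightarrow> (\<forall>p\<in>P. c p \<in> X \<longrightarrow> Q (c p))" for Q
    unfolding P' using cU by blast
  have ex: "(\<exists>x\<in>U. (x, P') \<in> E \<and> relE E R' x (c p) \<and> Q x) \<longleftrightarrow> (\<exists>q\<in>P. leq q p \<and> Q (c q))" if "p \<in> P" for p Q
    unfolding P' using cU relE_poset[OF P that] by blast
  show ?thesis
    unfolding genericE_def all
    by (intro ball_cong refl imp_cong) (simp add: ex generic_condition_iff[OF P X] cong: bex_cong conj_cong)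
qed

end

text \<open>The parameters enumerate the copies under \<open>c\<close> of the relations in
  \<open>reqs\<close> and the relation \<open>TD\<close>. If \<open>X\<close> is closed, the
  conditions with code in \<open>X\<close> then form a closed family in which every dense set coded
  in \<open>X\<close> is dense, as \<open>borel_generic_condition\<close> demands.\<close>

lemma (in actionable) generic_in_club:
  fixes \<theta> :: "'u rel"
  assumes H: "is_H \<theta> U E" and small: "|Pow (positive_borel I)| <o \<theta>"
    and P: "poset_in U E (positive_borel I) (\<subseteq>) c P' R'"
  obtains r a where "r \<in> U" "a \<in> U"
    "\<forall>X\<subseteq>U. countable X \<and> membership.closedE U E X \<and> r \<in> X \<and> a \<in> X \<longrightarrow>
      (\<forall>p\<in>positive_borel I. c p \<in> X \<longrightarrow>
        (\<exists>q\<in>positive_borel I. q \<subseteq> p \<and> generic_condition X E (positive_borel I) (\<subseteq>) c q))"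
proof -
  interpret hereditary \<theta> U E using H by unfold_locales
  define PB where "PB = positive_borel I"
  have cU: "\<And>p. p \<in> PB \<Longrightarrow> c p \<in> U" and inj: "inj_on c PB"
    using P unfolding poset_in_def PB_def by auto
  \<comment> \<open>The codes of sets of conditions. As \<open>ext E\<close> is injective on them,
    there are at most as many as elements of \<open>Pow PB\<close>; the bound on the power set makes
    relations involving them small enough to be coded.\<close>
  define DD where "DD = {D\<in>U. ext E D \<subseteq> c ` PB}"
  have smallP: "|c ` PB| <o \<theta>"
    using card_le[OF ordLeq_transitive[OF card_of_image ordLess_imp_ordLeq[OF card_of_Pow]]] small
    unfolding PB_def .
  have smallDD: "|DD| <o \<theta>"
  proof (rule card_le)
    have "ext E ` DD \<subseteq> (`) c ` Pow PB" 
    proof (intro subsetI, elim imageE)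
      fix A D assume "A = ext E D" "D \<in> DD"
      then have "A \<subseteq> c ` PB" by (simp add: DD_def)
      then show "A \<in> (`) c ` Pow PB" by (auto simp: subset_image_iff)
    qed
    moreover have "inj_on (ext E) DD" using ext_inj by (rule inj_on_subset) (auto simp: DD_def)
    ultimately have "|DD| \<le>o |(`) c ` Pow PB|" using card_of_ordLeq[of DD] by blast
    then show "|DD| \<le>o |Pow PB|" using card_of_image ordLeq_transitive by blast
  qed (use small PB_def in simp)
  define TR where "TR R = {(c x, c y, c z) | x y z. x \<in> PB \<and> y \<in> PB \<and> z \<in> PB \<and> R x y z}"
    for R :: "'a set \<Rightarrow> 'a set \<Rightarrow> 'a set \<Rightarrow> bool"
  \<comment> \<open>The code of the dense set is an argument of the relation, so this single
    relation takes care of all dense sets coded in \<open>X\<close>.\<close>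
  define TD where "TD = {(c h, D', c f) | h D D' f. h \<in> PB \<and> D' \<in> U \<and> dense_in PB (\<subseteq>) D \<and>
    ext E D' = c ` D \<and> f \<in> D \<and> f \<subseteq> h}"
  have TDsub: "TD \<subseteq> c ` PB \<times> DD \<times> c ` PB"
  proof
    fix t assume "t \<in> TD"
    then obtain h D D' f where t: "t = (c h, D', c f)" "h \<in> PB" "D' \<in> U" "dense_in PB (\<subseteq>) D"
      "ext E D' = c ` D" "f \<in> D" unfolding TD_def by blast
    then have "D \<subseteq> PB" unfolding dense_in_def by blast
    then show "t \<in> c ` PB \<times> DD \<times> c ` PB" using t unfolding DD_def by auto
  qed
  have TRsub: "TR R \<subseteq> c ` PB \<times> c ` PB \<times> c ` PB" for R unfolding TR_def by auto
  have "|TD| <o \<theta>" "|TR R| <o \<theta>" for R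
    by (rule card_le[OF card_of_mono1[OF TDsub]] card_le[OF card_of_mono1[OF TRsub]],
        intro Times_small smallP smallDD)+
  then have smallT: "|T| <o \<theta>" if "T \<in> insert TD (TR ` reqs)" for T using that by auto
  have "TD \<subseteq> U \<times> U \<times> U" "TR R \<subseteq> U \<times> U \<times> U" for R
    using TDsub TRsub[of R] cU unfolding DD_def by auto
  then have subT: "T \<subseteq> U \<times> U \<times> U" if "T \<in> insert TD (TR ` reqs)" for T using that by blast
  have cT: "countable (insert TD (TR ` reqs))" using countable_reqs by simp
  obtain r a where ra: "r \<in> U" "a \<in> U" and club:
    "\<forall>X\<subseteq>U. closedE X \<and> r \<in> X \<and> a \<in> X \<longrightarrow> (\<forall>T\<in>insert TD (TR ` reqs).
      \<forall>x\<in>X. \<forall>y\<in>X. (\<exists>z. (x, y, z) \<in> T) \<longrightarrow> (\<exists>z\<in>X. (x, y, z) \<in> T))"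
    by (rule club_parameters[OF cT insert_not_empty subT smallT])
  show thesis
  proof (rule that[OF ra], intro allI impI ballI, elim conjE)
    fix X p assume X: "X \<subseteq> U" "countable X" "closedE X" "r \<in> X" "a \<in> X"
      and p: "p \<in> positive_borel I" "c p \<in> X"
    have clubX: "\<forall>T\<in>insert TD (TR ` reqs). \<forall>x\<in>X. \<forall>y\<in>X. (\<exists>z. (x, y, z) \<in> T) \<longrightarrow> (\<exists>z\<in>X. (x, y, z) \<in> T)"
      using club[rule_format, of X] X by simp
    define N where "N = {p\<in>PB. c p \<in> X}"
    define \<D> where "\<D> = {D. dense_in PB (\<subseteq>) D \<and> (\<exists>D'\<in>X. ext E D' = c ` D)}"
    have "inj_on c N" using inj by (rule inj_on_subset) (auto simp: N_def)
    moreover have "countable (c ` N)" using X(2) by (rule countable_subset[rotated]) (auto simp: N_def)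
    ultimately have cN: "countable N" using countable_image_inj_on by blast
    have "closed_under reqs N"
      unfolding closed_under_def
    proof (intro ballI)
      fix R x y assume R: "R \<in> reqs" and x: "x \<in> N" and y: "y \<in> N"
      then obtain z where "z \<in> PB" "R x y z"
        using closed_under_positive_borel unfolding closed_under_def N_def PB_def by blast
      then have "(c x, c y, c z) \<in> TR R" using x y unfolding TR_def N_def by blast
      then obtain w where w: "w \<in> X" "(c x, c y, w) \<in> TR R"
        using bspec[OF clubX, of "TR R"] R x y unfolding N_def by blast
      then obtain x' y' z' where z': "x' \<in> PB" "y' \<in> PB" "z' \<in> PB" "R x' y' z'" "c x = c x'" "c y = c y'" "w = c z'"
        unfolding TR_def by blast
      then have "x = x'" "y = y'" using x y inj unfolding N_def inj_on_def by blast+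
      then show "\<exists>z\<in>N. R x y z" using z' w(1) unfolding N_def by blast
    qed
    moreover have "countable \<D>"
    proof -
      have "(`) c ` \<D> \<subseteq> ext E ` X" unfolding \<D>_def by auto
      then have "countable ((`) c ` \<D>)" using X(2) countable_image countable_subset by metis
      moreover have "inj_on ((`) c) \<D>"
        using inj by (intro inj_on_subset[OF inj_on_image_Pow[OF inj]]) (auto simp: \<D>_def dense_in_def)
      ultimately show ?thesis using countable_image_inj_on by blast
    qed
    moreover have "\<exists>F\<in>D \<inter> N. F \<subseteq> h" if D: "D \<in> \<D>" and h: "h \<in> N" for D h
    proof -
      obtain D' where D': "dense_in PB (\<subseteq>) D" "D' \<in> X" "ext E D' = c ` D" using D unfolding \<D>_def by blast
      obtain f where "f \<in> D" "f \<subseteq> h" using D'(1) h unfolding dense_in_def N_def by blast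
      then have "(c h, D', c f) \<in> TD" using D' h X(1) unfolding TD_def N_def by blast
      then obtain w where w: "w \<in> X" "(c h, D', w) \<in> TD"
        using bspec[OF clubX, of TD] h D'(2) unfolding N_def by blast
      then obtain h' D0 f' where f': "h' \<in> PB" "c h = c h'" "dense_in PB (\<subseteq>) D0" "ext E D' = c ` D0"
        "f' \<in> D0" "f' \<subseteq> h'" "w = c f'"
        unfolding TD_def by blast
      have "h = h'" using f'(1,2) h inj unfolding N_def inj_on_def by blast
      moreover have "D0 = D"
        using inj_on_image_eq_iff[OF inj, of D0 D] f'(3,4) D'(1,3) unfolding dense_in_def by simp
      moreover have "f' \<in> PB" using f'(3,5) unfolding dense_in_def by blast
      ultimately show ?thesis using f' w(1) unfolding N_def by blast
    qed
    moreover have "N \<subseteq> positive_borel I" "p \<in> N" using p unfolding N_def PB_def by auto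
    ultimately obtain q where q: "q \<in> positive_borel I" "q \<subseteq> p" "\<And>D. D \<in> \<D> \<Longrightarrow> q \<subseteq> \<Union>(D \<inter> N)"
      using borel_generic_condition[OF cN, of p \<D>] by blast
    have "generic_condition X E (positive_borel I) (\<subseteq>) c q"
      unfolding generic_condition_def
    proof (intro conjI q(1) allI impI ballI)
      fix D s assume D: "dense_in (positive_borel I) (\<subseteq>) D \<and> (\<exists>D'\<in>X. ext E D' = c ` D)"
        and s: "s \<in> positive_borel I" "s \<subseteq> q"
      have "D \<in> \<D>" using D unfolding \<D>_def PB_def by blast
      then have sub: "s \<subseteq> \<Union>(D \<inter> N)" using q(3) s(2) by blast
      \<comment> \<open>The countably many sets \<open>s \<inter> d\<close> cover \<open>s\<close>,
        so one of them is positive; it is the common extension that compatibility asks for.\<close>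
      have "\<exists>d\<in>D \<inter> N. s \<inter> d \<notin> I"
      proof (rule ccontr)
        assume "\<not> ?thesis"
        then have "(\<Union>d\<in>D \<inter> N. s \<inter> d) \<in> I" using cN by (intro ideal_UN) auto
        then have "s \<in> I" using sub by (elim ideal_mono) blast
        then show False using s(1) by (simp add: positive_borel_def)
      qed
      then obtain d where d: "d \<in> D" "d \<in> N" "s \<inter> d \<notin> I" by blast
      have "s \<inter> d \<in> positive_borel I"
        using d s(1) unfolding N_def PB_def positive_borel_def by auto
      then have "compatible (positive_borel I) (\<subseteq>) d s" unfolding compatible_def by blast
      then show "\<exists>d\<in>D. c d \<in> X \<and> compatible (positive_borel I) (\<subseteq>) d s" using d unfolding N_def by blast
    qed
    then show "\<exists>q\<in>positive_borel I. q \<subseteq> p \<and> generic_condition X E (positive_borel I) (\<subseteq>) c q"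
      using q by blast
  qed
qed

theorem theorem2p2:
  fixes I :: "'a::polish_space set set"
  assumes "actionable_sigma_ideal I"
  shows "proper_poset TYPE('u) (positive_borel I) (\<subseteq>)"
proof -
  obtain \<G> where I: "sigma_ideal I" "actionable_hypergraphs \<G>" "\<And>A. A \<in> I \<longleftrightarrow>
      (\<exists>\<C>. countable \<C> \<and> \<C> \<subseteq> {B \<in> sets borel. \<exists>G\<in>\<G>. anticlique G B} \<and> A \<subseteq> \<Union>\<C>)"
    using assms unfolding actionable_sigma_ideal_def by blast
  then obtain \<Gamma> :: "nat monoid" and \<phi> where
    G: "countable \<G>" "\<forall>G\<in>\<G>. analytic_in seq_space G" "borel_action \<Gamma> \<phi>"
    "\<forall>G\<in>\<G>. \<forall>e\<in>G. \<exists>Q\<in>orbits \<Gamma> UNIV \<phi>. rng e \<subseteq> Q"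
    "\<forall>G\<in>\<G>. \<forall>g\<in>carrier \<Gamma>. map_edge (\<phi> g) ` G \<in> \<G>"
    unfolding actionable_hypergraphs_def by blast
  interpret actionable I \<G> \<Gamma> \<phi>
    by (rule actionable.intro[OF I(1) G(1) _ G(3) _ _ I(3)]) (use G(2,4,5) in blast)+
  show ?thesis
    unfolding proper_poset_def
  proof (intro allI impI ballI, elim conjE)
    fix \<theta> :: "'u rel" and U E c P' R' M p
    assume H: "is_H \<theta> U E" and small: "|Pow (positive_borel I)| <o \<theta>"
      and P: "poset_in U E (positive_borel I) (\<subseteq>) c P' R'"
      and M: "countable M" "elementary_submodel M U E" "P' \<in> M" "R' \<in> M"
      and p: "p \<in> positive_borel I" "c p \<in> M"
    interpret hereditary \<theta> U E using H by unfold_locales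
    obtain r a where ra: "r \<in> U" "a \<in> U" and club:
      "\<forall>X\<subseteq>U. countable X \<and> closedE X \<and> r \<in> X \<and> a \<in> X \<longrightarrow>
        (\<forall>p\<in>positive_borel I. c p \<in> X \<longrightarrow>
          (\<exists>q\<in>positive_borel I. q \<subseteq> p \<and> generic_condition X E (positive_borel I) (\<subseteq>) c q))"
      by (rule generic_in_club[OF H small P])
    have "genericE P' R' X" if "X \<subseteq> U" "countable X" "closedE X" "r \<in> X" "a \<in> X" for X
      unfolding genericE_iff[OF P that(1)] using club[rule_format, of X] that by simp
    then have "genericE P' R' M" by (rule reflect_generic[OF M(2,1,3,4) ra])
    moreover have "M \<subseteq> U" using M(2) by (simp add: elementary_submodel_def)
    ultimately show "\<exists>q\<in>positive_borel I. q \<subseteq> p \<and> generic_condition M E (positive_borel I) (\<subseteq>) c q"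
      using genericE_iff[OF P] p by blast
  qed
qed

end
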